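(* For every $\varepsilon > 0$, there exist a uniform approximate lattice $\Lambda' \subseteq \mathbb{R}^2$ and $g \in L^2(\mathbb{R})$ such that $\pi(\Lambda')g$ is complete in $L^2(\mathbb{R})$ and $D^+(\Lambda') < \varepsilon$ (so that in particular $D^-(\Lambda') < \varepsilon$), where $\pi$ is the Schrödinger representation of $\mathbb{R}^2$ on $L^2(\mathbb{R})$.
   Context: The (projective) Schrödinger representation is $\pi(x,\xi)f(t) = e^{2\pi i\xi t}f(t-x)$ for $(x,\xi)\in\mathbb{R}^2$, $f\in L^2(\mathbb{R})$. $\pi(\Lambda')g$ denotes the family $(\pi(\lambda)g)_{\lambda\in\Lambda'}$; it is complete if its closed linear span is $L^2(\mathbb{R})$. A set $\Lambda\subseteq\mathbb{R}^2$ is relatively dense if there is a compact $K$ with $\Lambda+K=\mathbb{R}^2$; uniformly discrete if there is a non-empty open set $V$ with $|\Lambda\cap(x+V)|\leq 1$ for all $x\in\mathbb{R}^2$; Delone if both. $\Lambda$ is a uniform approximate lattice if it is a Delone set with $0\in\Lambda$, $-\Lambda=\Lambda$, and there is a finite set $F\subseteq\mathbb{R}^2$ with $\Lambda+\Lambda\subseteq F+\Lambda$. Let $\mu$ be Lebesgue measure on $\mathbb{R}^2$. A strong Følner sequence in $\mathbb{R}^2$ is a sequence $(K_n)_{n\in\mathbb{N}}$ of non-null compact sets such that for all compact $K$ one has $\mu(K_n\triangle(K_n+K))/\mu(K_n)\to 0$ and $\mu((K_n+K)\cap(K_n^c+K))/\mu(K_n)\to 0$, where $K_n^c=\mathbb{R}^2\setminus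 K_n$ (for example, closed Euclidean balls of radius $n$ centered at $0$). The lower and upper Beurling densities are $D^-(\Lambda)=\liminf_{n\to\infty}\inf_{x}|\Lambda\cap(x+K_n)|/\mu(K_n)$ and $D^+(\Lambda)=\limsup_{n\to\infty}\sup_{x}|\Lambda\cap(x+K_n)|/\mu(K_n)$; they do not depend on the choice of strong Følner sequence. *)

theory Defs
  imports "HOL-Analysis.Analysis"
begin

text \<open>
  The space \<open>L\<^sup>2(\<real>)\<close> is handled through Borel representatives; all notions below are invariant
  under changes on null sets, and every class of Lebesgue measurable functions contains a Borel one.
\<close>

definition L2 :: "(real \<Rightarrow> complex) set" where
  "L2 = {f \<in> borel_measurable lborel. integrable lborel (\<lambda>t. (norm (f t))\<^sup>2)}"

definition L2_norm :: "(real \<Rightarrow> complex) \<Rightarrow> real" where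
  "L2_norm f = sqrt (LINT t|lborel. (norm (f t))\<^sup>2)"

definition linear_span :: "(real \<Rightarrow> complex) set \<Rightarrow> (real \<Rightarrow> complex) set" where
  "linear_span S = {(\<lambda>t. \<Sum>h\<in>F. c h * h t) | F c. finite F \<and> F \<subseteq> S}"

definition L2_closure :: "(real \<Rightarrow> complex) set \<Rightarrow> (real \<Rightarrow> complex) set" where
  "L2_closure A = {f \<in> L2. \<forall>e>0. \<exists>h\<in>A. L2_norm (\<lambda>t. f t - h t) < e}"

definition complete_family :: "('i \<Rightarrow> real \<Rightarrow> complex) \<Rightarrow> 'i set \<Rightarrow> bool" where
  "complete_family u I \<longleftrightarrow> u ` I \<subseteq> L2 \<and> L2_closure (linear_span (u ` I)) = L2"

definition schroedinger :: "real \<times> real \<Rightarrow> (real \<Rightarrow> complex) \<Rightarrow> real \<Rightarrow> complex" where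
  "schroedinger = (\<lambda>(x, \<xi>) f t. exp (2 * of_real pi * \<i> * of_real \<xi> * of_real t) * f (t - x))"


definition relatively_dense :: "(real \<times> real) set \<Rightarrow> bool" where
  "relatively_dense \<Lambda> \<longleftrightarrow> (\<exists>K. compact K \<and> \<Lambda> + K = UNIV)"

definition uniformly_discrete :: "(real \<times> real) set \<Rightarrow> bool" where
  "uniformly_discrete \<Lambda> \<longleftrightarrow>
     (\<exists>V. open V \<and> V \<noteq> {} \<and>
        (\<forall>x. finite (\<Lambda> \<inter> (+) x ` V) \<and> card (\<Lambda> \<inter> (+) x ` V) \<le> 1))"

definition delone :: "(real \<times> real) set \<Rightarrow> bool" where
  "delone \<Lambda> \<longleftrightarrow> relatively_dense \<Lambda> \<and> uniformly_discrete \<Lambda>"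

text \<open>On sets, \<open>-\<close> is complementation, so the reflected set is written as an image.\<close>

definition uniform_approximate_lattice :: "(real \<times> real) set \<Rightarrow> bool" where
  "uniform_approximate_lattice \<Lambda> \<longleftrightarrow>
     delone \<Lambda> \<and> 0 \<in> \<Lambda> \<and> uminus ` \<Lambda> = \<Lambda> \<and> (\<exists>F. finite F \<and> \<Lambda> + \<Lambda> \<subseteq> F + \<Lambda>)"


text \<open>
  The test sets \<open>K\<close> have to be nonempty: for \<open>K = {}\<close> the first quotient is constantly 1.
\<close>

definition strong_folner :: "(nat \<Rightarrow> (real \<times> real) set) \<Rightarrow> bool" where
  "strong_folner Kn \<longleftrightarrow>
     (\<forall>n. compact (Kn n) \<and> measure lborel (Kn n) > 0) \<and>
     (\<forall>K. compact K \<and> K \<noteq> {} \<longrightarrow>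
        (\<lambda>n. measure lborel (sym_diff (Kn n) (Kn n + K)) / measure lborel (Kn n)) \<longlonglongrightarrow> 0 \<and>
        (\<lambda>n. measure lborel ((Kn n + K) \<inter> ((- Kn n) + K)) / measure lborel (Kn n)) \<longlonglongrightarrow> 0)"

text \<open>
  Cardinalities in the densities are taken as counting measure, so that infinite sets
  have cardinality \<open>\<infinity>\<close>.
\<close>

definition counting_ratio :: "(real \<times> real) set \<Rightarrow> (real \<times> real) set \<Rightarrow> real \<times> real \<Rightarrow> ennreal" where
  "counting_ratio \<Lambda> K x = emeasure (count_space UNIV) (\<Lambda> \<inter> (+) x ` K) / emeasure lborel K"

definition lower_beurling_density :: "(nat \<Rightarrow> (real \<times> real) set) \<Rightarrow> (real \<times> real) set \<Rightarrow> ennreal" where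
  "lower_beurling_density Kn \<Lambda> = liminf (\<lambda>n. INF x. counting_ratio \<Lambda> (Kn n) x)"

definition upper_beurling_density :: "(nat \<Rightarrow> (real \<times> real) set) \<Rightarrow> (real \<times> real) set \<Rightarrow> ennreal" where
  "upper_beurling_density Kn \<Lambda> = limsup (\<lambda>n. SUP x. counting_ratio \<Lambda> (Kn n) x)"

lemma strong_folner_cball: "strong_folner (\<lambda>n. cball 0 (real (Suc n)))"
proof -
  define C where "C = (\<lambda>r. cball (0::real\<times>real) r)"
  define v where "v = unit_ball_vol (real DIM(real \<times> real))"
  have v: "v > 0" unfolding v_def by simp
  have m: "measure lborel (C r) = v * r\<^sup>2" if "r \<ge> 0" for r
    using content_cball[OF that, of "0::real\<times>real"] by (simp add: C_def v_def power2_eq_square)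
  have key: "(\<lambda>n. measure lborel (A n) / measure lborel (C (real (Suc n)))) \<longlonglongrightarrow> 0"
    if R: "R \<ge> 0" and A: "\<And>n. A n \<in> sets lborel"
      "\<And>n. A n \<subseteq> C (real (Suc n) + R) - C' (real (Suc n) - R)" and C': "C' = (\<lambda>r. ball (0::real\<times>real) r)"
    for A R C'
  proof (rule tendsto_sandwich)
    show "\<forall>\<^sub>F n in sequentially. 0 \<le> measure lborel (A n) / measure lborel (C (real (Suc n)))"
      by simp
    show "\<forall>\<^sub>F n in sequentially. measure lborel (A n) / measure lborel (C (real (Suc n)))
        \<le> ((real (Suc n) + R)\<^sup>2 - (real (Suc n) - R)\<^sup>2) / (real (Suc n))\<^sup>2"
    proof (rule eventually_mono[OF eventually_ge_at_top[of "nat \<lceil>R\<rceil>"]])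
      fix n assume "nat \<lceil>R\<rceil> \<le> n"
      then have n: "real (Suc n) - R \<ge> 0" by linarith
      have fin: "emeasure lborel (C r) < \<infinity>" for r
        unfolding C_def by (intro emeasure_bounded_finite) auto
      have "measure lborel (A n) \<le> measure lborel (C (real (Suc n) + R) - C' (real (Suc n) - R))"
        using A fin[of "real (Suc n) + R"]
        by (intro measure_mono_fmeasurable fmeasurable_Diff fmeasurableI) (auto simp: C_def C')
      also have "\<dots> = measure lborel (C (real (Suc n) + R)) - measure lborel (C' (real (Suc n) - R))"
        using fin[of "real (Suc n) + R"] R
        by (intro measure_Diff) (auto simp: C_def C')
      also have "measure lborel (C' (real (Suc n) - R)) = v * (real (Suc n) - R)\<^sup>2"
        using content_ball[OF n, of "0::real\<times>real"] by (simp add: C' v_def power2_eq_square)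
      finally have "measure lborel (A n) \<le> v * ((real (Suc n) + R)\<^sup>2 - (real (Suc n) - R)\<^sup>2)"
        using R by (simp add: m algebra_simps)
      then have "measure lborel (A n) / (v * (real (Suc n))\<^sup>2)
          \<le> v * ((real (Suc n) + R)\<^sup>2 - (real (Suc n) - R)\<^sup>2) / (v * (real (Suc n))\<^sup>2)"
        using v by (intro divide_right_mono) auto
      then show "measure lborel (A n) / measure lborel (C (real (Suc n)))
        \<le> ((real (Suc n) + R)\<^sup>2 - (real (Suc n) - R)\<^sup>2) / (real (Suc n))\<^sup>2"
        using v by (simp add: m)
    qed
    have "(\<lambda>n. 4 * R * inverse (real (Suc n))) \<longlonglongrightarrow> 4 * R * 0"
      by (intro tendsto_intros LIMSEQ_inverse_real_of_nat)
    moreover have "((real (Suc n) + R)\<^sup>2 - (real (Suc n) - R)\<^sup>2) / (real (Suc n))\<^sup>2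
        = 4 * R * inverse (real (Suc n))" for n
    proof -
      have "(real (Suc n) + R)\<^sup>2 - (real (Suc n) - R)\<^sup>2 = 4 * R * real (Suc n)"
        by (simp add: power2_eq_square algebra_simps)
      then show ?thesis by (simp add: power2_eq_square divide_simps del: of_nat_Suc)
    qed
    ultimately show "(\<lambda>n. ((real (Suc n) + R)\<^sup>2 - (real (Suc n) - R)\<^sup>2) / (real (Suc n))\<^sup>2) \<longlonglongrightarrow> 0"
      by simp
  qed simp
  have main: "(\<lambda>n. measure lborel (sym_diff (C (real (Suc n))) (C (real (Suc n)) + K)) / measure lborel (C (real (Suc n)))) \<longlonglongrightarrow> 0 \<and>
      (\<lambda>n. measure lborel ((C (real (Suc n)) + K) \<inter> ((- C (real (Suc n))) + K)) / measure lborel (C (real (Suc n)))) \<longlonglongrightarrow> 0"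
    if K: "compact K" "K \<noteq> {}" for K
  proof -
    obtain R0 where R0: "\<And>k. k \<in> K \<Longrightarrow> norm k \<le> R0"
      using compact_imp_bounded[OF K(1)] bounded_iff by blast
    define R where "R = max R0 0"
    have R: "R \<ge> 0" "\<And>k. k \<in> K \<Longrightarrow> norm k \<le> R" using R0 by (force simp: R_def)+
    obtain k0 where k0: "k0 \<in> K" using K by auto
    have up: "C r + K \<subseteq> C (r + R)" for r
    proof
      fix x assume "x \<in> C r + K"
      then obtain a k where *: "x = a + k" "a \<in> C r" "k \<in> K" by (auto elim: set_plus_elim)
      then show "x \<in> C (r + R)"
        using norm_triangle_ineq[of a k] R(2)[of k] by (simp add: C_def)
    qed
    have lo: "x \<in> C r + K" if "x \<in> ball 0 (r - R)" for x r
    proof -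
      have "norm (x - k0) \<le> r" using norm_triangle_ineq4[of x k0] R(2)[OF k0] that by simp
      then have "x - k0 \<in> C r" by (simp add: C_def)
      then have "(x - k0) + k0 \<in> C r + K" using k0 by (rule set_plus_intro)
      then show ?thesis by simp
    qed
    have out: "x \<notin> ball 0 (r - R)" if x: "x \<in> (- C r) + K" for x r
    proof -
      obtain a k where *: "x = a + k" "a \<in> - C r" "k \<in> K" using x by (auto elim: set_plus_elim)
      then show ?thesis using norm_triangle_ineq4[of x k] R(2)[of k] by (simp add: C_def)
    qed
    have sub: "C r \<subseteq> C (r + R)" "ball 0 (r - R) \<subseteq> C r" for r using R(1) by (auto simp: C_def)
    have plus: "A + B = (\<Union>x\<in>A. \<Union>y\<in>B. {x + y})" for A B :: "(real \<times> real) set"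
      unfolding set_plus_def by blast
    have cK: "compact (C r + K)" for r
      unfolding plus using K(1) by (intro compact_sums') (auto simp: C_def)
    have oK: "open ((- C r) + K)" for r
      unfolding plus by (intro open_sums) (auto simp: C_def)
    note [measurable] = borel_compact[OF cK] borel_open[OF oK]
    have [measurable]: "C r \<in> sets borel" for r by (simp add: C_def)
    show ?thesis
    proof (intro conjI key[OF R(1) _ _ refl])
      fix n
      let ?r = "real (Suc n)"
      show "sym_diff (C ?r) (C ?r + K) \<in> sets lborel" by measurable
      show "sym_diff (C ?r) (C ?r + K) \<subseteq> C (?r + R) - ball 0 (?r - R)"
        using up[of ?r] lo[of _ ?r] sub[of ?r] by blast
      show "(C ?r + K) \<inter> ((- C ?r) + K) \<in> sets lborel" by measurable
      show "(C ?r + K) \<inter> ((- C ?r) + K) \<subseteq> C (?r + R) - ball 0 (?r - R)"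
        using up[of ?r] out[of _ ?r] by blast
    qed
  qed
  show ?thesis
    unfolding strong_folner_def using main m[of "real (Suc _)"] v
    by (auto simp: C_def simp del: of_nat_Suc)
qed

end

theory Submission
  imports Defs "HOL-Library.Nat_Bijection"
begin

text \<open>
  The window \<open>g\<close> lives on \<open>[0,1)\<close>, so integer translates decouple and it suffices that the
  functions \<open>exp(\<pi> i n t) g(t)\<close>, with \<open>n\<close> in a sparse set \<open>B\<close> of integers, span \<open>L\<^sup>2[0,1)\<close>. Any
  relatively dense symmetric subset of a lattice containing 0 is a uniform approximate lattice, so
  \<open>B\<close> may be irregular: \<open>B\<close> is a union of blocks \<open>{k + mN | 0 < \<bar>m\<bar> < M}\<close> in which every integer
  \<open>k\<close> recurs while \<open>N\<close> grows so fast that the elements of \<open>B\<close> stay far apart. The Fejer kernel in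
  \<open>z = exp(\<pi> i N t)\<close> has constant term 1 and is at most \<open>4 / (M \<bar>z - 1\<bar>\<^sup>2)\<close>. If \<open>g\<close> is at most
  \<open>C \<bar>z - 1\<bar>\<^sup>2\<close> with \<open>C\<close> small compared to \<open>M\<close>, then a block approximates the missing function
  \<open>exp(\<pi> i k t) g(t)\<close> uniformly. By Borel-Cantelli one \<open>g\<close>, nonzero almost everywhere on the unit
  interval, satisfies these bounds for all blocks at once.
\<close>

section \<open>The closed span in \<open>L\<^sup>2\<close>\<close>

lemma L2_I: "f \<in> borel_measurable lborel \<Longrightarrow> integrable lborel (\<lambda>t. (norm (f t))\<^sup>2) \<Longrightarrow> f \<in> L2"
  by (simp add: L2_def)

lemma L2_measurable: "f \<in> L2 \<Longrightarrow> f \<in> borel_measurable borel"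
  by (simp add: L2_def)

lemma L2_integrable: "f \<in> L2 \<Longrightarrow> integrable lborel (\<lambda>t. (norm (f t))\<^sup>2)"
  by (simp add: L2_def)

lemma norm_add_power2_le:
  fixes a b :: "'a::real_normed_vector"
  shows "(norm (a + b))\<^sup>2 \<le> 2 * (norm a)\<^sup>2 + 2 * (norm b)\<^sup>2"
proof -
  have "(norm (a + b))\<^sup>2 \<le> (norm a + norm b)\<^sup>2"
    by (intro power_mono norm_triangle_ineq) auto
  also have "\<dots> \<le> 2 * (norm a)\<^sup>2 + 2 * (norm b)\<^sup>2"
    using zero_le_power2[of "norm a - norm b"] by (simp add: power2_eq_square algebra_simps)
  finally show ?thesis .
qed

lemma L2_dominated:
  assumes [measurable]: "f \<in> borel_measurable borel" and G: "G \<in> L2"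
    and le: "AE t in lborel. norm (f t) \<le> norm (G t)"
  shows "f \<in> L2"
proof (rule L2_I)
  show "integrable lborel (\<lambda>t. (norm (f t))\<^sup>2)"
    by (rule Bochner_Integration.integrable_bound[OF L2_integrable[OF G]])
      (use le in \<open>auto elim!: eventually_mono intro: power_mono\<close>)
qed simp

lemma L2_scale:
  assumes "f \<in> L2" shows "(\<lambda>t. c * f t) \<in> L2"
proof (rule L2_I)
  note [measurable] = L2_measurable[OF assms]
  show "(\<lambda>t. c * f t) \<in> borel_measurable lborel" by measurable
  show "integrable lborel (\<lambda>t. (norm (c * f t))\<^sup>2)"
    using L2_integrable[OF assms] by (simp add: norm_mult power_mult_distrib)
qed

lemma L2_add:
  assumes "f \<in> L2" "g \<in> L2" shows "(\<lambda>t. f t + g t) \<in> L2"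
proof (rule L2_I)
  note [measurable] = assms[THEN L2_measurable]
  show "(\<lambda>t. f t + g t) \<in> borel_measurable lborel" by measurable
  have "integrable lborel (\<lambda>t. 2 * (norm (f t))\<^sup>2 + 2 * (norm (g t))\<^sup>2)"
    using assms[THEN L2_integrable] by auto
  then show "integrable lborel (\<lambda>t. (norm (f t + g t))\<^sup>2)"
    by (rule Bochner_Integration.integrable_bound) (use norm_add_power2_le in auto)
qed

lemma L2_zero: "(\<lambda>_. 0) \<in> L2"
  by (simp add: L2_def)

lemma L2_diff:
  assumes "f \<in> L2" "g \<in> L2" shows "(\<lambda>t. f t - g t) \<in> L2"
  using L2_add[OF assms(1) L2_scale[OF assms(2), of "-1"]] by simp

lemma L2_sum: "finite I \<Longrightarrow> (\<And>i. i \<in> I \<Longrightarrow> f i \<in> L2) \<Longrightarrow> (\<lambda>t. \<Sum>i\<in>I. f i t) \<in> L2"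
  by (induction I rule: finite_induct) (auto intro: L2_zero L2_add)

lemma L2_shift:
  assumes "f \<in> L2" shows "(\<lambda>t. f (t - a)) \<in> L2"
proof (rule L2_I)
  note [measurable] = L2_measurable[OF assms]
  show "(\<lambda>t. f (t - a)) \<in> borel_measurable lborel" by measurable
  show "integrable lborel (\<lambda>t. (norm (f (t - a)))\<^sup>2)"
    using lborel_integrable_real_affine[OF L2_integrable[OF assms], of 1 "-a"] by (simp add: algebra_simps)
qed

lemma L2_norm_shift: "L2_norm (\<lambda>t. f (t - a)) = L2_norm f"
  unfolding L2_norm_def
  using lborel_integral_real_affine[of 1 "\<lambda>t. (norm (f t))\<^sup>2" "-a"] by (simp add: algebra_simps)

lemma L2_norm_less_iff: "e > 0 \<Longrightarrow> L2_norm f < e \<longleftrightarrow> (LINT t|lborel. (norm (f t))\<^sup>2) < e\<^sup>2"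
  unfolding L2_norm_def using real_sqrt_less_iff[of _ "e\<^sup>2"] by simp

text \<open>No Minkowski inequality is required: by \<open>norm_add_power2_le\<close>, each norm
  below \<open>e / 2\<close> contributes less than \<open>2 * (e / 2)^2\<close> to the squared norm,
  and the two bounds add up to \<open>e^2\<close>.\<close>

lemma L2_norm_add_less:
  assumes "f \<in> L2" "g \<in> L2" "e > 0" "L2_norm f < e / 2" "L2_norm g < e / 2"
  shows "L2_norm (\<lambda>t. f t + g t) < e"
proof -
  have "(LINT t|lborel. (norm (f t + g t))\<^sup>2)
      \<le> (LINT t|lborel. 2 * (norm (f t))\<^sup>2 + 2 * (norm (g t))\<^sup>2)"
    using assms(1,2) L2_integrable
    by (intro integral_mono norm_add_power2_le L2_integrable L2_add Bochner_Integration.integrable_add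
        integrable_mult_right)
  also have "\<dots> = 2 * (LINT t|lborel. (norm (f t))\<^sup>2) + 2 * (LINT t|lborel. (norm (g t))\<^sup>2)"
    using assms(1,2)[THEN L2_integrable] by simp
  also have "\<dots> < 2 * (e / 2)\<^sup>2 + 2 * (e / 2)\<^sup>2"
    using assms(3-5) L2_norm_less_iff[of "e / 2"] by (intro add_strict_mono mult_strict_left_mono) auto
  finally show ?thesis using assms(3) by (simp add: L2_norm_less_iff power2_eq_square)
qed

lemma L2_closureI:
  "f \<in> L2 \<Longrightarrow> (\<And>e. e > 0 \<Longrightarrow> \<exists>h\<in>A. L2_norm (\<lambda>t. f t - h t) < e) \<Longrightarrow> f \<in> L2_closure A"
  by (simp add: L2_closure_def)

lemma L2_closure_subset: "L2_closure A \<subseteq> L2"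
  by (auto simp: L2_closure_def)

lemma subset_L2_closure:
  assumes "A \<subseteq> L2" shows "A \<subseteq> L2_closure A"
proof
  fix f assume f: "f \<in> A"
  show "f \<in> L2_closure A"
    using assms f by (intro L2_closureI bexI[OF _ f]) (auto simp: L2_norm_def)
qed

lemma L2_closure_closed:
  assumes A: "A \<subseteq> L2" and f: "f \<in> L2"
    and ex: "\<And>e. e > 0 \<Longrightarrow> \<exists>h\<in>L2_closure A. L2_norm (\<lambda>t. f t - h t) < e"
  shows "f \<in> L2_closure A"
proof (rule L2_closureI[OF f])
  fix e :: real assume e: "e > 0"
  obtain h where h: "h \<in> L2_closure A" "L2_norm (\<lambda>t. f t - h t) < e / 2"
    using ex[of "e / 2"] e by auto
  obtain k where k: "k \<in> A" "L2_norm (\<lambda>t. h t - k t) < e / 2"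
    using h(1) e unfolding L2_closure_def by (auto dest!: spec[of _ "e / 2"])
  have "L2_norm (\<lambda>t. (f t - h t) + (h t - k t)) < e"
    using h k e A f L2_closure_subset by (intro L2_norm_add_less L2_diff) auto
  then show "\<exists>k\<in>A. L2_norm (\<lambda>t. f t - k t) < e" using k by (intro bexI[of _ k]) auto
qed

text \<open>Dominated convergence for \<open>|f - F n|^2\<close> with majorant
  \<open>4 * |G|^2\<close>. Later limits in closed spans, from a single missing character up to an
  arbitrary element of \<open>L2\<close>, are taken with it.\<close>

lemma L2_closure_dominated:
  assumes A: "A \<subseteq> L2" and F: "\<And>n. F n \<in> L2_closure A"
    and f[measurable]: "f \<in> borel_measurable borel" and G: "G \<in> L2"
    and le: "\<And>n. AE t in lborel. norm (F n t) \<le> norm (G t)"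
    and lim: "AE t in lborel. (\<lambda>n. F n t) \<longlonglongrightarrow> f t"
  shows "f \<in> L2_closure A"
proof -
  have FL: "F n \<in> L2" for n using F L2_closure_subset by blast
  note [measurable] = L2_measurable[OF FL] L2_measurable[OF G]
  have AEn: "AE t in lborel. \<forall>n. norm (F n t) \<le> norm (G t)"
    using le by (simp add: AE_all_countable)
  have fG: "AE t in lborel. norm (f t) \<le> norm (G t)"
    using AEn lim
  proof eventually_elim
    case (elim t)
    then show ?case by (intro LIMSEQ_le_const2[OF tendsto_norm[of _ "f t"]]) auto
  qed
  have fL: "f \<in> L2" by (rule L2_dominated[OF f G fG])
  have "(\<lambda>n. LINT t|lborel. (norm (f t - F n t))\<^sup>2) \<longlonglongrightarrow> (LINT t::real|lborel. 0)"
  proof (rule integral_dominated_convergence)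
    show "integrable lborel (\<lambda>t. 4 * (norm (G t))\<^sup>2)" using L2_integrable[OF G] by simp
    show "AE t in lborel. (\<lambda>n. (norm (f t - F n t))\<^sup>2) \<longlonglongrightarrow> 0"
      using lim
    proof eventually_elim
      case (elim t)
      have "(\<lambda>n. (norm (f t - F n t))\<^sup>2) \<longlonglongrightarrow> (norm (f t - f t))\<^sup>2"
        by (intro tendsto_intros elim)
      then show ?case by simp
    qed
    show "AE t in lborel. norm ((norm (f t - F n t))\<^sup>2) \<le> 4 * (norm (G t))\<^sup>2" for n
      using fG le[of n]
    proof eventually_elim
      case (elim t)
      have "norm (f t - F n t) \<le> 2 * norm (G t)"
        using norm_triangle_ineq4[of "f t" "F n t"] elim by linarith
      then have "(norm (f t - F n t))\<^sup>2 \<le> (2 * norm (G t))\<^sup>2" by (intro power_mono) auto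
      then show ?case by (simp add: power_mult_distrib)
    qed
  qed auto
  then have lim0: "(\<lambda>n. LINT t|lborel. (norm (f t - F n t))\<^sup>2) \<longlonglongrightarrow> 0" by simp
  show ?thesis
  proof (rule L2_closure_closed[OF A fL])
    fix e :: real assume e: "e > 0"
    have "\<forall>\<^sub>F n in sequentially. (LINT t|lborel. (norm (f t - F n t))\<^sup>2) < e\<^sup>2"
      using lim0 e by (intro order_tendstoD) auto
    then obtain n where "(LINT t|lborel. (norm (f t - F n t))\<^sup>2) < e\<^sup>2"
      by (auto simp: eventually_sequentially)
    then show "\<exists>h\<in>L2_closure A. L2_norm (\<lambda>t. f t - h t) < e"
      using F e by (intro bexI[of _ "F n"]) (simp_all add: L2_norm_less_iff)
  qed
qed

section \<open>Linear spans and their closures\<close>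

lemma linear_span_base: "f \<in> S \<Longrightarrow> f \<in> linear_span S"
  unfolding linear_span_def by (rule CollectI, rule exI[of _ "{f}"], rule exI[of _ "\<lambda>_. 1"]) auto

lemma linear_span_zero: "(\<lambda>_. 0) \<in> linear_span S"
  unfolding linear_span_def by (rule CollectI, rule exI[of _ "{}"]) auto

lemma linear_span_scale:
  assumes "f \<in> linear_span S" shows "(\<lambda>t. a * f t) \<in> linear_span S"
proof -
  obtain F c where F: "finite F" "F \<subseteq> S" "f = (\<lambda>t. \<Sum>h\<in>F. c h * h t)"
    using assms by (auto simp: linear_span_def)
  show ?thesis unfolding linear_span_def
    by (rule CollectI, rule exI[of _ F], rule exI[of _ "\<lambda>h. a * c h"])
      (use F in \<open>auto simp: sum_distrib_left mult.assoc\<close>)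
qed

lemma linear_span_add:
  assumes "f \<in> linear_span S" "g \<in> linear_span S" shows "(\<lambda>t. f t + g t) \<in> linear_span S"
proof -
  obtain F c where F: "finite F" "F \<subseteq> S" "f = (\<lambda>t. \<Sum>h\<in>F. c h * h t)"
    using assms by (auto simp: linear_span_def)
  obtain G d where G: "finite G" "G \<subseteq> S" "g = (\<lambda>t. \<Sum>h\<in>G. d h * h t)"
    using assms by (auto simp: linear_span_def)
  \<comment> \<open>A function may occur in both \<open>F\<close> and \<open>G\<close>, so the two
    coefficient families are extended by zero and added on the union.\<close>
  let ?e = "\<lambda>h. (if h \<in> F then c h else 0) + (if h \<in> G then d h else 0)"
  have "(\<Sum>h\<in>F \<union> G. ?e h * h t) = f t + g t" for t
  proof -
    have "(\<Sum>h\<in>F \<union> G. ?e h * h t)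
       = (\<Sum>h\<in>F \<union> G. (if h \<in> F then c h * h t else 0)) + (\<Sum>h\<in>F \<union> G. (if h \<in> G then d h * h t else 0))"
      unfolding sum.distrib[symmetric] by (intro sum.cong) (auto simp: algebra_simps)
    also have "\<dots> = f t + g t"
      using F G by (simp add: sum.inter_restrict[symmetric] Int_absorb1 Int_absorb2 sum.If_cases)
    finally show ?thesis .
  qed
  then show ?thesis unfolding linear_span_def
    by (intro CollectI exI[of _ "F \<union> G"] exI[of _ ?e]) (use F G in auto)
qed

lemma linear_span_sum:
  "finite I \<Longrightarrow> (\<And>i. i \<in> I \<Longrightarrow> f i \<in> linear_span S) \<Longrightarrow> (\<lambda>t. \<Sum>i\<in>I. f i t) \<in> linear_span S"
  by (induction I rule: finite_induct) (auto intro: linear_span_zero linear_span_add)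

lemma linear_span_subset_L2: "S \<subseteq> L2 \<Longrightarrow> linear_span S \<subseteq> L2"
  by (auto simp: linear_span_def intro!: L2_sum L2_scale)

abbreviation closed_span :: "(real \<Rightarrow> complex) set \<Rightarrow> (real \<Rightarrow> complex) set" where
  "closed_span S \<equiv> L2_closure (linear_span S)"

lemma closed_span_base: "S \<subseteq> L2 \<Longrightarrow> linear_span S \<subseteq> closed_span S"
  by (intro subset_L2_closure linear_span_subset_L2)

lemma closed_span_scale:
  assumes S: "S \<subseteq> L2" and f: "f \<in> closed_span S"
  shows "(\<lambda>t. c * f t) \<in> closed_span S"
proof (rule L2_closureI)
  show "(\<lambda>t. c * f t) \<in> L2" using f L2_closure_subset by (intro L2_scale) auto
  fix e :: real assume e: "e > 0"
  \<comment> \<open>\<open>1 + norm c\<close> in place of \<open>norm c\<close> covers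
    \<open>c = 0\<close> as well.\<close>
  then have "e / (1 + norm c) > 0" by (simp add: add_pos_nonneg)
  then obtain h where h: "h \<in> linear_span S" "L2_norm (\<lambda>t. f t - h t) < e / (1 + norm c)"
    using f unfolding L2_closure_def by blast
  have "L2_norm (\<lambda>t. c * f t - c * h t) = norm c * L2_norm (\<lambda>t. f t - h t)"
    unfolding L2_norm_def right_diff_distrib[symmetric] norm_mult power_mult_distrib
    by (simp add: real_sqrt_mult)
  also have "\<dots> \<le> (1 + norm c) * L2_norm (\<lambda>t. f t - h t)"
    by (intro mult_right_mono) (auto simp: L2_norm_def)
  also have "\<dots> < e" using h(2) by (simp add: pos_less_divide_eq add_pos_nonneg mult.commute)
  finally show "\<exists>h\<in>linear_span S. L2_norm (\<lambda>t. c * f t - h t) < e"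
    using linear_span_scale[OF h(1)] by (intro bexI[of _ "\<lambda>t. c * h t"])
qed

lemma closed_span_add:
  assumes S: "S \<subseteq> L2" and f: "f \<in> closed_span S" and g: "g \<in> closed_span S"
  shows "(\<lambda>t. f t + g t) \<in> closed_span S"
proof (rule L2_closureI)
  have fg: "f \<in> L2" "g \<in> L2" using f g L2_closure_subset by auto
  then show "(\<lambda>t. f t + g t) \<in> L2" by (rule L2_add)
  fix e :: real assume e: "e > 0"
  then have "e / 2 > 0" by simp
  with f g obtain h k where h: "h \<in> linear_span S" "L2_norm (\<lambda>t. f t - h t) < e / 2"
    and k: "k \<in> linear_span S" "L2_norm (\<lambda>t. g t - k t) < e / 2"
    unfolding L2_closure_def by blast
  have "L2_norm (\<lambda>t. (f t - h t) + (g t - k t)) < e"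
    using h k e fg linear_span_subset_L2[OF S] by (intro L2_norm_add_less L2_diff) auto
  then show "\<exists>h\<in>linear_span S. L2_norm (\<lambda>t. f t + g t - h t) < e"
    using linear_span_add[OF h(1) k(1)] by (intro bexI[of _ "\<lambda>t. h t + k t"]) (auto simp: algebra_simps)
qed

lemma closed_span_zero: "S \<subseteq> L2 \<Longrightarrow> (\<lambda>_. 0) \<in> closed_span S"
  using closed_span_base linear_span_zero by blast

lemma closed_span_sum:
  "S \<subseteq> L2 \<Longrightarrow> finite I \<Longrightarrow> (\<And>i. i \<in> I \<Longrightarrow> f i \<in> closed_span S) \<Longrightarrow>
    (\<lambda>t. \<Sum>i\<in>I. f i t) \<in> closed_span S"
  by (rotate_tac, induction I rule: finite_induct) (auto intro: closed_span_zero closed_span_add)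

section \<open>The Fejer kernel and the weight\<close>

text \<open>In the phase \<open>2 pi i xi t\<close> this is the frequency \<open>n / 2\<close>. The
  common period is 2 rather than 1, so the values at 0 and 1 are not tied together.\<close>

definition character :: "int \<Rightarrow> real \<Rightarrow> complex" where
  "character n t = cis (pi * of_int n * t)"

lemma character_add: "character (m + n) t = character m t * character n t"
  by (simp add: character_def cis_mult algebra_simps)

lemma character_0 [simp]: "character 0 t = 1"
  by (simp add: character_def)

lemma norm_character [simp]: "norm (character n t) = 1"
  by (simp add: character_def)

lemma continuous_on_character: "continuous_on S (character n)"
  unfolding character_def by (intro continuous_intros)

lemma measurable_character [measurable]: "character n \<in> borel_measurable borel"
  by (intro borel_measurable_continuous_onI continuous_on_character)

lemma character_mult_power: "character (int a * N) t = character N t ^ a"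
  by (induction a) (simp_all add: character_add distrib_right)

lemma character_minus: "character (- n) t = cnj (character n t)"
  by (simp add: character_def cis_cnj)

lemma character_diff_mult:
  "character ((int a - int b) * N) t = character N t ^ a * cnj (character N t ^ b)"
proof -
  have "(int a - int b) * N = int a * N + - (int b * N)" by (simp add: algebra_simps)
  then show ?thesis by (simp only: character_add character_minus character_mult_power)
qed

text \<open>With \<open>z = character N t\<close>, the double sum is the squared modulus of a
  geometric sum in \<open>z\<close>, and multiplying that sum by \<open>z - 1\<close> leaves
  \<open>z ^ M - 1\<close>, of norm at most 2. The product form stays valid where
  \<open>z = 1\<close>.\<close>

lemma fejer_kernel_bound:
  "norm (\<Sum>a<M. \<Sum>b<M. character ((int a - int b) * N) t) * (norm (character N t - 1))\<^sup>2 \<le> 4"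
proof -
  let ?z = "character N t"
  have "(\<Sum>a<M. \<Sum>b<M. character ((int a - int b) * N) t) = (\<Sum>a<M. ?z ^ a) * cnj (\<Sum>a<M. ?z ^ a)"
    by (simp only: character_diff_mult sum_product cnj_sum)
  then have "norm (\<Sum>a<M. \<Sum>b<M. character ((int a - int b) * N) t) * (norm (?z - 1))\<^sup>2
      = (norm (\<Sum>a<M. ?z ^ a) * norm (?z - 1))\<^sup>2"
    by (simp add: norm_mult power2_eq_square algebra_simps del: cnj_sum)
  also have "norm (\<Sum>a<M. ?z ^ a) * norm (?z - 1) = norm (?z ^ M - 1)"
    by (simp add: norm_mult[symmetric] power_diff_1_eq mult.commute)
  also have "(norm (?z ^ M - 1))\<^sup>2 \<le> 2\<^sup>2"
    using norm_triangle_ineq4[of "?z ^ M" 1] by (intro power_mono) (auto simp: norm_power)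
  finally show ?thesis by simp
qed

section \<open>Weights that are positive almost everywhere\<close>

lemma AE_character_neq_1:
  assumes "N \<noteq> 0" shows "AE t in lborel. character N t \<noteq> 1"
proof -
  have "{t. character N t = 1} \<subseteq> range (\<lambda>n::int. 2 * of_int n / of_int N)"
  proof
    fix t assume "t \<in> {t. character N t = 1}"
    then have "cos (pi * of_int N * t) = 1" by (simp add: character_def complex_eq_iff)
    then obtain n :: int where "pi * of_int N * t = of_int n * 2 * pi"
      unfolding cos_one_2pi_int by blast
    then have "t = 2 * of_int n / of_int N" using assms by (simp add: field_simps)
    then show "t \<in> range (\<lambda>n::int. 2 * of_int n / of_int N)" by blast
  qed
  then have "countable {t. character N t = 1}" by (rule countable_subset) simp
  then have "{t. character N t = 1} \<in> null_sets lborel" by (rule countable_imp_null_set_lborel)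
  then show ?thesis by (rule AE_I') auto
qed

text \<open>As \<open>C\<close> grows, the sets decrease to a set of zeros of \<open>q\<close>,
  which is null, so continuity of measure from above applies; restricting to \<open>[0,1]\<close>
  provides the finite measure it requires.\<close>

lemma sublevel_set_small:
  fixes q :: "real \<Rightarrow> real"
  assumes [measurable]: "q \<in> borel_measurable borel" and q0: "\<And>t. 0 \<le> q t"
    and pos: "AE t in lborel. q t \<noteq> 0" and d: "\<delta> > 0"
  shows "\<exists>C>0. measure lborel {t\<in>{0..1}. C * q t < 1} < \<delta>"
proof -
  define A where "A n = {t\<in>{0..1}. real (Suc n) * q t < 1}" for n
  have Am[measurable]: "A n \<in> sets lborel" for n unfolding A_def by measurable
  have "emeasure lborel (A n) \<le> emeasure lborel {0..1::real}" for n
    by (rule emeasure_mono) (auto simp: A_def)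
  then have fin: "emeasure lborel (A n) \<noteq> \<infinity>" for n
    by (rule order.strict_trans1[THEN less_imp_neq]) simp
  have dec: "decseq A"
  proof (rule decseq_SucI, rule subsetI)
    fix n t assume "t \<in> A (Suc n)"
    then show "t \<in> A n" using q0[of t] by (simp add: A_def algebra_simps)
  qed
  have sub: "(\<Inter>n. A n) \<subseteq> {t. q t = 0}"
  proof
    fix t assume t: "t \<in> (\<Inter>n. A n)"
    show "t \<in> {t. q t = 0}"
    proof (rule ccontr)
      assume "t \<notin> {t. q t = 0}"
      then have "q t > 0" using q0[of t] by simp
      then obtain n where n: "1 < of_nat n * q t" using reals_Archimedean3 by blast
      moreover have "real (Suc n) * q t < 1" using t by (auto simp: A_def)
      ultimately show False using \<open>q t > 0\<close> by (simp add: algebra_simps)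
    qed
  qed
  have "AE t in lborel. t \<notin> (\<Inter>n. A n)"
    using pos by eventually_elim (use sub in auto)
  moreover have "(\<Inter>n. A n) \<in> sets lborel" using Am by (intro sets.countable_INT) blast+
  ultimately have "(\<Inter>n. A n) \<in> null_sets lborel" by (simp add: AE_iff_null_sets)
  then have zero: "measure lborel (\<Inter>n. A n) = 0" by (rule measure_eq_0_null_sets)
  have "(\<lambda>n. measure lborel (A n)) \<longlonglongrightarrow> measure lborel (\<Inter>n. A n)"
    by (rule Lim_measure_decseq) (use Am dec fin in auto)
  then have "\<forall>\<^sub>F n in sequentially. measure lborel (A n) < \<delta>"
    using zero d by (intro order_tendstoD(2)) auto
  then obtain n where "measure lborel (A n) < \<delta>" by (auto simp: eventually_sequentially)
  then show ?thesis by (intro exI[of _ "real (Suc n)"]) (auto simp: A_def)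
qed

text \<open>\<open>w\<close> is the infimum of the functions \<open>min 1 (C j * q j)\<close>. The
  sublevel sets have summable measure, so by Borel-Cantelli almost every point of
  \<open>[0,1]\<close> lies in only finitely many of them; there the infimum is bounded below by a
  minimum of finitely many positive numbers.\<close>

lemma common_minorant:
  fixes q :: "nat \<Rightarrow> real \<Rightarrow> real"
  assumes [measurable]: "\<And>j. q j \<in> borel_measurable borel" and q0: "\<And>j t. 0 \<le> q j t"
    and pos: "\<And>j. AE t in lborel. q j t \<noteq> 0" and C: "\<And>j. C j > 0"
    and small: "\<And>j. measure lborel {t\<in>{0..1}. C j * q j t < 1} \<le> (1/2) ^ j"
  obtains w where "w \<in> borel_measurable borel" "\<And>t. 0 \<le> w t" "\<And>t. w t \<le> 1"
    "\<And>j t. w t \<le> C j * q j t" "AE t in lborel. t \<in> {0..1} \<longrightarrow> w t \<noteq> 0"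
proof
  define w where "w t = (INF j. min 1 (C j * q j t))" for t
  have ge0: "0 \<le> min 1 (C j * q j t)" for j t using C[of j] q0[of j t] by simp
  have bdd: "bdd_below (range (\<lambda>j. min 1 (C j * q j t)))" for t
    using ge0 by (intro bdd_belowI[of _ 0]) auto
  have le: "w t \<le> min 1 (C j * q j t)" for t j
    unfolding w_def by (intro cINF_lower bdd) auto
  show "w \<in> borel_measurable borel" unfolding w_def by (intro borel_measurable_cINF_real) auto
  show "0 \<le> w t" for t unfolding w_def by (intro cINF_greatest ge0) auto
  show "w t \<le> 1" for t using le[of t 0] by simp
  show "w t \<le> C j * q j t" for j t using le[of t j] by simp
  let ?A = "\<lambda>j. {t\<in>{0..1}. C j * q j t < 1}"
  have "AE t in lborel. \<forall>\<^sub>F j in sequentially. t \<in> space lborel - ?A j"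
  proof (rule borel_cantelli_AE1)
    show "?A j \<in> sets lborel" for j by measurable
    have "emeasure lborel (?A j) \<le> emeasure lborel {0..1::real}" for j
      by (rule emeasure_mono) auto
    then show "emeasure lborel (?A j) < \<infinity>" for j
      by (rule order.strict_trans1) simp
    show "summable (\<lambda>j. measure lborel (?A j))"
      by (rule summable_comparison_test'[of "\<lambda>j. (1/2::real) ^ j" 0]) (use small in auto)
  qed
  moreover have "AE t in lborel. \<forall>j. q j t \<noteq> 0" using pos by (simp add: AE_all_countable)
  ultimately show "AE t in lborel. t \<in> {0..1} \<longrightarrow> w t \<noteq> 0"
  proof eventually_elim
    case (elim t)
    show ?case
    proof
      assume t: "t \<in> {0..1}"
      obtain J where J: "\<And>j. j \<ge> J \<Longrightarrow> C j * q j t \<ge> 1"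
        using elim(1) t unfolding eventually_sequentially by force
      \<comment> \<open>From \<open>J\<close> on, \<open>min 1 (C j * q j t)\<close> equals 1, which
        is why 1 is inserted; it also keeps the set nonempty for \<open>J = 0\<close>.\<close>
      define m where "m = Min (insert 1 ((\<lambda>j. C j * q j t) ` {..<J}))"
      have "m > 0" unfolding m_def using elim(2) q0 C by (subst Min_gr_iff) (auto simp: less_le)
      moreover have "m \<le> min 1 (C j * q j t)" for j
      proof (cases "j < J")
        case True
        then show ?thesis unfolding m_def by (intro min.boundedI Min_le) auto
      next
        case False
        then have "C j * q j t \<ge> 1" using J by simp
        moreover have "m \<le> 1" unfolding m_def by (intro Min_le) auto
        ultimately show ?thesis by simp
      qed
      then have "m \<le> w t" unfolding w_def by (intro cINF_greatest) auto
      ultimately show "w t \<noteq> 0" by simp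
    qed
  qed
qed

section \<open>Sparse frequencies\<close>

definition separated :: "int \<Rightarrow> int set \<Rightarrow> bool" where
  "separated D S \<longleftrightarrow> (\<forall>a\<in>S. \<forall>b\<in>S. a \<noteq> b \<longrightarrow> D \<le> \<bar>a - b\<bar>)"

text \<open>Each block is placed beyond all earlier ones. Its length may depend on its step, because
  the constants that dictate the length are known only once the step is. Omitting
  \<open>m = 0\<close> matters: the centres \<open>k j\<close> are arbitrary and may run through all
  integers.\<close>

lemma separated_progressions:
  fixes k :: "nat \<Rightarrow> int" and L :: "nat \<Rightarrow> int \<Rightarrow> int" and D :: int
  assumes D: "D \<ge> 1" and L: "\<And>j N. L j N \<ge> 1"
  obtains N :: "nat \<Rightarrow> int" where "\<And>j. N j \<ge> D"
    "separated D (\<Union>j. {k j + m * N j | m. m \<noteq> 0 \<and> \<bar>m\<bar> < L j (N j)})"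
proof
  \<comment> \<open>With \<open>b j\<close> below, a bound for the moduli in block \<open>j\<close>,
    the recursion reads \<open>N (Suc j) = b j + |k (Suc j)| + D\<close>. Elements of block
    \<open>Suc j\<close> then have modulus at least \<open>b j + D\<close>, hence stay
    \<open>D\<close> away from all earlier blocks.\<close>
  define N where "N = rec_nat D (\<lambda>j n. L j n * n + \<bar>k j\<bar> + \<bar>k (Suc j)\<bar> + D)"
  have N0: "N 0 = D" and NS: "N (Suc j) = L j (N j) * N j + \<bar>k j\<bar> + \<bar>k (Suc j)\<bar> + D" for j
    by (simp_all add: N_def)
  define b where "b j = L j (N j) * N j + \<bar>k j\<bar>" for j
  have N: "N j \<ge> D" for j
  proof (induction j)
    case (Suc j)
    then have "L j (N j) * N j \<ge> 0" using D L[of j "N j"] by simp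
    then show ?case by (simp add: NS)
  qed (simp add: N0)
  then show "\<And>j. N j \<ge> D" .
  have Npos: "N j > 0" for j using N[of j] D by linarith
  have bN: "b j \<ge> N j" for j
    using Npos[of j] mult_right_mono[OF L[of j "N j"], of "N j"] unfolding b_def by linarith
  have NSb: "N (Suc j) = b j + \<bar>k (Suc j)\<bar> + D" for j unfolding NS b_def ..
  have "b j \<le> b (Suc j)" for j using bN[of "Suc j"] NSb[of j] D by linarith
  then have bmono: "i \<le> j \<Longrightarrow> b i \<le> b j" for i j by (rule lift_Suc_mono_le)
  have far: "D \<le> \<bar>x - y\<bar>"
    if ij: "i < j" and x: "x = k i + m * N i" "\<bar>m\<bar> < L i (N i)" and y: "y = k j + n * N j" "n \<noteq> 0"
    for i j m n x y
  proof -
    obtain j' where j': "j = Suc j'" "i \<le> j'" using ij by (cases j) auto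
    have "\<bar>x\<bar> \<le> \<bar>k i\<bar> + \<bar>m\<bar> * N i" using x Npos[of i] by (auto simp: abs_mult intro: abs_triangle_ineq[THEN order_trans])
    also have "\<dots> \<le> b i" using x(2) Npos[of i] by (simp add: b_def mult_right_mono)
    finally have "\<bar>x\<bar> \<le> b j'" using bmono[OF j'(2)] by simp
    moreover have "\<bar>n\<bar> * N j \<ge> N j" using y(2) Npos[of j] mult_right_mono[of 1 "\<bar>n\<bar>" "N j"] by linarith
    then have "\<bar>n * N j\<bar> \<ge> N j" using Npos[of j] by (simp add: abs_mult)
    then have "\<bar>y\<bar> \<ge> N j - \<bar>k j\<bar>" unfolding y(1) by linarith
    ultimately show ?thesis using NSb[of j'] unfolding j'(1) by linarith
  qed
  show "separated D (\<Union>j. {k j + m * N j | m. m \<noteq> 0 \<and> \<bar>m\<bar> < L j (N j)})"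
    unfolding separated_def
  proof (intro ballI impI)
    fix x y assume "x \<in> (\<Union>j. {k j + m * N j | m. m \<noteq> 0 \<and> \<bar>m\<bar> < L j (N j)})"
      and "y \<in> (\<Union>j. {k j + m * N j | m. m \<noteq> 0 \<and> \<bar>m\<bar> < L j (N j)})" and ne: "x \<noteq> y"
    then obtain i j m n where x: "x = k i + m * N i" "m \<noteq> 0" "\<bar>m\<bar> < L i (N i)"
      and y: "y = k j + n * N j" "n \<noteq> 0" "\<bar>n\<bar> < L j (N j)" by blast
    consider "i < j" | "j < i" | "i = j" by linarith
    then show "D \<le> \<bar>x - y\<bar>"
    proof cases
      case 1 then show ?thesis using far x y by blast
    next
      case 2 then show ?thesis using far[of j i y n x m] x y by (simp add: abs_minus_commute)
    next
      case 3
      then have "x - y = (m - n) * N i" "m \<noteq> n" using x y ne by (auto simp: algebra_simps)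
      then have "\<bar>x - y\<bar> = \<bar>m - n\<bar> * N i" "\<bar>m - n\<bar> \<ge> 1" using Npos[of i] by (auto simp: abs_mult)
      then show ?thesis using N[of i] Npos[of i] mult_right_mono[of 1 "\<bar>m - n\<bar>" "N i"] by linarith
    qed
  qed
qed

text \<open>The order of the choices matters: first a constant \<open>C j N\<close> for every
  conceivable step \<open>N\<close>, then a length \<open>M j N\<close> large against it, then the
  actual steps by \<open>separated_progressions\<close>, and last one weight below all
  \<open>C j (N j) * q (N j)\<close>.\<close>

lemma sparse_frequencies_and_weight:
  fixes D :: int
  assumes D: "D \<ge> 1"
  obtains B :: "int set" and w :: "real \<Rightarrow> real" where
    "separated D B" "w \<in> borel_measurable borel" "\<And>t. 0 \<le> w t" "\<And>t. w t \<le> 1"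
    "AE t in lborel. t \<in> {0..1} \<longrightarrow> w t \<noteq> 0"
    "\<And>k n. \<exists>N M C. (\<forall>a<M. \<forall>b<M. a \<noteq> b \<longrightarrow> k + (int a - int b) * N \<in> B) \<and>
       (\<forall>t. w t \<le> C * (norm (character N t - 1))\<^sup>2) \<and> 4 * C * real (Suc n) \<le> real M \<and> M > 0 \<and> C > 0"
proof -
  define q where "q N t = (norm (character N t - 1))\<^sup>2" for N t
  have [measurable]: "q N \<in> borel_measurable borel" for N unfolding q_def by measurable
  \<comment> \<open>For \<open>N = 0\<close> the function \<open>q N\<close> vanishes and no
    constant makes the measure small; the guard makes the choice total, and the steps used later are
    at least \<open>D\<close>.\<close>
  have "\<exists>C>0. N \<noteq> 0 \<longrightarrow> measure lborel {t\<in>{0..1}. C * q N t < 1} \<le> (1/2) ^ j" for j N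
  proof (cases "N = 0")
    case False
    have "\<exists>C>0. measure lborel {t\<in>{0..1}. C * q N t < 1} < (1/2) ^ j"
      by (rule sublevel_set_small) (use AE_character_neq_1[OF False] in \<open>auto simp: q_def\<close>)
    then show ?thesis by (auto intro: less_imp_le)
  qed (auto intro: exI[of _ 1])
  note C_ex = this
  define C where "C j N = (SOME c. c > 0 \<and> (N \<noteq> 0 \<longrightarrow>
      measure lborel {t\<in>{0..1}. c * q N t < 1} \<le> (1/2) ^ j))" for j :: nat and N
  have C: "C j N > 0" and small: "N \<noteq> 0 \<Longrightarrow> measure lborel {t\<in>{0..1}. C j N * q N t < 1} \<le> (1/2) ^ j"
    for j N using someI_ex[OF C_ex[of N j]] unfolding C_def by blast+
  \<comment> \<open>An index \<open>j\<close> encodes an integer together with an accuracy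
    \<open>n\<close>, so every integer is the centre of a block for each accuracy.\<close>
  define k where "k j = int_decode (fst (prod_decode j))" for j
  define M where "M j N = nat \<lceil>4 * C j N * real (Suc (snd (prod_decode j)))\<rceil>" for j N
  have Mpos: "M j N > 0" for j N using C[of j N] by (simp add: M_def del: of_nat_Suc)
  obtain N :: "nat \<Rightarrow> int" where N: "\<And>j. N j \<ge> D"
    and sep: "separated D (\<Union>j. {k j + m * N j | m. m \<noteq> 0 \<and> \<bar>m\<bar> < int (M j (N j))})"
    by (rule separated_progressions[of D "\<lambda>j N. int (M j N)" k])
      (use D Mpos in \<open>auto simp: int_one_le_iff_zero_less\<close>)
  have Nne: "N j \<noteq> 0" for j using N[of j] D by linarith
  obtain w where w: "w \<in> borel_measurable borel" "\<And>t. 0 \<le> w t" "\<And>t. w t \<le> 1"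
    "\<And>j t. w t \<le> C j (N j) * q (N j) t" "AE t in lborel. t \<in> {0..1} \<longrightarrow> w t \<noteq> 0"
  proof (rule common_minorant[of "\<lambda>j. q (N j)" "\<lambda>j. C j (N j)"])
    show "AE t in lborel. q (N j) t \<noteq> 0" for j
      using AE_character_neq_1[OF Nne[of j]] by eventually_elim (simp add: q_def)
  qed (use small Nne C in \<open>auto simp: q_def\<close>)
  let ?B = "\<Union>j. {k j + m * N j | m. m \<noteq> 0 \<and> \<bar>m\<bar> < int (M j (N j))}"
  show thesis
  proof (rule that[OF sep w(1-3) w(5)])
    fix l :: int and n :: nat
    define j where "j = prod_encode (int_encode l, n)"
    have j: "k j = l" "snd (prod_decode j) = n" by (simp_all add: j_def k_def)
    have "l + (int a - int b) * N j \<in> ?B" if "a < M j (N j)" "b < M j (N j)" "a \<noteq> b" for a b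
      using that j by (intro UN_I[of j]) auto
    moreover have "4 * C j (N j) * real (Suc n) \<le> real (M j (N j))"
      unfolding M_def j by (simp add: real_nat_ceiling_ge)
    ultimately show "\<exists>N M C. (\<forall>a<M. \<forall>b<M. a \<noteq> b \<longrightarrow> l + (int a - int b) * N \<in> ?B) \<and>
       (\<forall>t. w t \<le> C * (norm (character N t - 1))\<^sup>2) \<and> 4 * C * real (Suc n) \<le> real M \<and> M > 0 \<and> C > 0"
      using w(4)[of _ j] Mpos[of j "N j"] C[of j "N j"] unfolding q_def
      by (intro exI[of _ "N j"] exI[of _ "M j (N j)"] exI[of _ "C j (N j)"]) auto
  qed
qed

section \<open>Completeness on the unit interval\<close>

lemma indicator_L2: "(indicator {0..1} :: real \<Rightarrow> complex) \<in> L2"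
proof (rule L2_I)
  have "(norm (indicator {0..1} t :: complex))\<^sup>2 = indicator {0..1} t" for t :: real
    by (simp add: indicator_def)
  then show "integrable lborel (\<lambda>t::real. (norm (indicator {0..1} t :: complex))\<^sup>2)"
    by (simp only: integrable_real_indicator) auto
qed simp

text \<open>Products of characters are characters, so the span is an algebra; the product case of
  the induction over polynomials rests on this.\<close>

lemma linear_span_character_mult:
  assumes p: "p \<in> linear_span (range character)" and q: "q \<in> linear_span (range character)"
  shows "(\<lambda>t. p t * q t) \<in> linear_span (range character)"
proof -
  have char: "(\<lambda>t. h t * q t) \<in> linear_span (range character)" if "h \<in> range character" for h
  proof -
    obtain m where h: "h = character m" using \<open>h \<in> range character\<close> by auto
    obtain F c where F: "finite F" "F \<subseteq> range character" "q = (\<lambda>t. \<Sum>h\<in>F. c h * h t)"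
      using q by (auto simp: linear_span_def)
    have "(\<lambda>t. character m t * h' t) \<in> linear_span (range character)" if "h' \<in> F" for h'
    proof -
      obtain n where "h' = character n" using F \<open>h' \<in> F\<close> by blast
      then have "(\<lambda>t. character m t * h' t) = character (m + n)" by (simp add: fun_eq_iff character_add)
      then show ?thesis by (simp add: linear_span_base)
    qed
    then have "(\<lambda>t. \<Sum>h'\<in>F. c h' * (character m t * h' t)) \<in> linear_span (range character)"
      by (intro linear_span_sum linear_span_scale F) auto
    then show ?thesis by (simp add: h F(3) sum_distrib_left mult_ac)
  qed
  obtain F c where F: "finite F" "F \<subseteq> range character" "p = (\<lambda>t. \<Sum>h\<in>F. c h * h t)"
    using p by (auto simp: linear_span_def)
  have "(\<lambda>t. \<Sum>h\<in>F. c h * (h t * q t)) \<in> linear_span (range character)"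
    using F by (intro linear_span_sum linear_span_scale char) auto
  then show ?thesis by (simp add: F(3) sum_distrib_right mult.assoc)
qed

lemma linear_span_character_const: "(\<lambda>_. c) \<in> linear_span (range character)"
  using linear_span_scale[OF linear_span_base[of "character 0" "range character"], of c] by simp

text \<open>The base case is \<open>cos (pi * t) = (character 1 t + character (-1) t) / 2\<close>; a
  bounded linear \<open>f\<close> on the reals is multiplication by \<open>f 1\<close>.\<close>

lemma real_polynomial_cos_in_span:
  assumes "real_polynomial_function (p :: real \<Rightarrow> real)"
  shows "(\<lambda>t. complex_of_real (p (cos (pi * t)))) \<in> linear_span (range character)"
  using assms
proof (induction rule: real_polynomial_function.induct)
  case (linear f)
  have f: "f x = f 1 * x" for x
    using linear_scale[OF bounded_linear.linear[OF linear], of x 1] by simp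
  have "complex_of_real (f (cos (pi * t))) = complex_of_real (f 1) / 2 * (character 1 t + character (-1) t)" for t
    by (subst f) (simp add: character_def complex_eq_iff)
  moreover have "(\<lambda>t. complex_of_real (f 1) / 2 * (character 1 t + character (-1) t)) \<in> linear_span (range character)"
    by (intro linear_span_scale linear_span_add linear_span_base) auto
  ultimately show ?case by (simp only:)
next
  case (const c)
  then show ?case by (rule linear_span_character_const)
next
  case (add f g)
  then show ?case using linear_span_add by (simp add: fun_eq_iff)
next
  case (mult f g)
  then show ?case using linear_span_character_mult by (simp add: fun_eq_iff)
qed

text \<open>
  The characters have period 2, so \<open>cos (\<pi>t)\<close> is injective on \<open>[0,1]\<close>, no periodicity is required of
  \<open>\<phi>\<close>, and the substitution \<open>y = cos (\<pi>t)\<close> reduces the claim to the Weierstrass theorem.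
\<close>

lemma trigonometric_approximation:
  fixes \<phi> :: "real \<Rightarrow> complex"
  assumes "continuous_on {0..1} \<phi>" "e > 0"
  obtains p where "p \<in> linear_span (range character)" "\<And>t. t \<in> {0..1} \<Longrightarrow> norm (\<phi> t - p t) < e"
proof -
  have "continuous_on {-1..1} (\<lambda>y. \<phi> (arccos y / pi))"
    by (rule continuous_on_compose2[OF assms(1)])
      (auto intro!: continuous_intros simp: arccos_lbound divide_le_eq arccos_ubound)
  then obtain P where P: "polynomial_function P"
    "\<And>y. y \<in> {-1..1} \<Longrightarrow> norm (\<phi> (arccos y / pi) - P y) < e"
    using Stone_Weierstrass_polynomial_function[of "{-1..1::real}" "\<lambda>y. \<phi> (arccos y / pi)" e] assms(2)
    by blast
  have "real_polynomial_function (\<lambda>y. Re (P y))" "real_polynomial_function (\<lambda>y. Im (P y))"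
    using P(1) bounded_linear_Re bounded_linear_Im unfolding polynomial_function_def by (auto simp: o_def)
  then have "(\<lambda>t. complex_of_real (Re (P (cos (pi * t)))) + \<i> * complex_of_real (Im (P (cos (pi * t)))))
      \<in> linear_span (range character)"
    by (intro linear_span_add linear_span_scale real_polynomial_cos_in_span)
  then have 1: "(\<lambda>t. P (cos (pi * t))) \<in> linear_span (range character)"
    by (simp only: complex_eq[symmetric])
  have 2: "norm (\<phi> t - P (cos (pi * t))) < e" if "t \<in> {0..1}" for t
  proof -
    have "arccos (cos (pi * t)) = pi * t" using that by (intro arccos_cos) (auto simp: mult_left_le)
    then show ?thesis using P(2)[of "cos (pi * t)"] by simp
  qed
  show thesis by (rule that[OF 1 2])
qed

text \<open>The radial retraction onto the disc of radius \<open>K\<close>. It makes continuous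
  approximants of a bounded function uniformly bounded without changing their limit, as dominated
  convergence demands.\<close>

lemma radial_truncation:
  fixes K :: real
  assumes K: "K > 0"
  obtains cl :: "complex \<Rightarrow> complex" where "continuous_on UNIV cl" "\<And>z. norm (cl z) \<le> K"
    "\<And>z. norm z \<le> K \<Longrightarrow> cl z = z"
proof
  define cl where "cl = (\<lambda>z::complex. complex_of_real (K / max K (norm z)) * z)"
  have pos: "max K (norm z) > 0" for z :: complex using K by (simp add: less_max_iff_disj)
  show "continuous_on UNIV cl" unfolding cl_def
    by (intro continuous_intros) (use pos in \<open>auto simp: less_le\<close>)
  show "norm (cl z) \<le> K" for z
  proof -
    have "norm z / max K (norm z) \<le> 1" using pos[of z] by (simp add: divide_le_eq)
    then have "K * (norm z / max K (norm z)) \<le> K * 1" using K by (intro mult_left_mono) auto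
    then show ?thesis using K pos[of z] by (simp add: cl_def norm_mult norm_divide)
  qed
  show "norm z \<le> K \<Longrightarrow> cl z = z" for z using K by (simp add: cl_def max_def)
qed

text \<open>What completeness takes from the construction: for every integer \<open>k\<close> and
  accuracy \<open>n\<close>, \<open>progression\<close> offers the off-diagonal frequencies of a
  Fejer kernel centred at \<open>k\<close>, with \<open>w\<close> small enough near the peaks of the
  kernel.\<close>

locale sparse_weight =
  fixes B :: "int set" and w :: "real \<Rightarrow> real"
  assumes w_measurable [measurable]: "w \<in> borel_measurable borel"
    and w_ge_0: "0 \<le> w t" and w_le_1: "w t \<le> 1"
    and w_nonzero: "AE t in lborel. t \<in> {0..1} \<longrightarrow> w t \<noteq> 0"
    and progression: "\<exists>N M C. (\<forall>a<M. \<forall>b<M. a \<noteq> b \<longrightarrow> k + (int a - int b) * N \<in> B) \<and>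
       (\<forall>t. w t \<le> C * (norm (character N t - 1))\<^sup>2) \<and> 4 * C * real (Suc n) \<le> real M \<and> M > 0 \<and> C > 0"
begin

text \<open>The half-open support gives the integer translates disjoint supports.\<close>

definition window :: "real \<Rightarrow> complex" where
  "window t = complex_of_real (w t) * indicator {0..<1} t"

lemma window_measurable [measurable]: "window \<in> borel_measurable borel"
  unfolding window_def by measurable

lemma norm_window: "norm (window t) = w t * indicator {0..<1} t"
  using w_ge_0[of t] by (simp add: window_def norm_mult indicator_def)

lemma norm_window_le: "norm (window t) \<le> indicator {0..1} t"
  using w_ge_0[of t] w_le_1[of t] by (auto simp: norm_window indicator_def)

lemma norm_mult_window_le:
  assumes "t \<in> {0..1} \<Longrightarrow> norm a \<le> K"
  shows "norm (a * window t) \<le> norm (complex_of_real K * indicator {0..1} t)"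
proof (cases "t \<in> {0..1}")
  case True
  have "norm a * norm (window t) \<le> K * 1"
    using assms[OF True] norm_window_le[of t] True order_trans[OF norm_ge_zero assms[OF True]]
    by (intro mult_mono) auto
  then show ?thesis using True by (simp add: norm_mult)
next
  case False
  then show ?thesis using norm_window_le[of t] by (simp add: norm_mult)
qed

lemma bounded_window_L2:
  assumes [measurable]: "q \<in> borel_measurable borel" and le: "\<And>t. t \<in> {0..1} \<Longrightarrow> norm (q t) \<le> K"
  shows "(\<lambda>t. q t * window t) \<in> L2"
  using norm_mult_window_le le by (intro L2_dominated[OF _ L2_scale[OF indicator_L2, of "complex_of_real K"]]) auto

lemma window_L2: "window \<in> L2"
  using bounded_window_L2[of "\<lambda>_. 1" 1] by simp

definition system :: "(real \<Rightarrow> complex) set" where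
  "system = (\<lambda>n t. character n t * window t) ` B"

lemma system_L2: "system \<subseteq> L2"
  unfolding system_def using bounded_window_L2[of "character _" 1] by auto

text \<open>The double sum over \<open>a, b < M\<close> consists of \<open>M\<close> diagonal terms,
  each the wanted function, and of off-diagonal terms in \<open>system\<close>. Solving for the
  diagonal part leaves the Fejer kernel times \<open>window\<close> as error; \<open>w\<close> damps
  the peaks, so the error is at most \<open>4 * C / M\<close>.\<close>

lemma character_window_approx:
  "\<exists>h\<in>linear_span system. \<forall>t. norm (character k t * window t - h t) \<le> inverse (real (Suc n))"
proof -
  obtain N M C where NM: "\<And>a b. a < M \<Longrightarrow> b < M \<Longrightarrow> a \<noteq> b \<Longrightarrow> k + (int a - int b) * N \<in> B"
    and C: "\<And>t. w t \<le> C * (norm (character N t - 1))\<^sup>2" and M: "4 * C * real (Suc n) \<le> real M" "M > 0"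
    and C_pos: "C > 0"
    using progression[of k n] by blast
  define x where "x a b t = character ((int a - int b) * N) t" for a b t
  \<comment> \<open>The sign moves the off-diagonal terms to the other side; dividing by
    \<open>M\<close> normalizes the \<open>M\<close> equal diagonal terms.\<close>
  define h where "h t = (- 1 / of_nat M) * (\<Sum>a<M. \<Sum>b<M. if a = b then 0
      else character (k + (int a - int b) * N) t * window t)" for t
  have "(\<lambda>t. if a = b then 0 else character (k + (int a - int b) * N) t * window t) \<in> linear_span system"
    if "a < M" "b < M" for a b
    using NM[OF that] linear_span_zero by (cases "a = b") (auto simp: system_def intro!: linear_span_base)
  then have hspan: "h \<in> linear_span system"
    unfolding h_def by (intro linear_span_scale linear_span_sum) auto
  have kernel: "character k t * window t - h t
      = character k t * window t / of_nat M * (\<Sum>a<M. \<Sum>b<M. x a b t)" for t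
  proof -
    have "(\<Sum>b<M. x a b t) = (\<Sum>b<M. if a = b then 0 else x a b t) + 1" if "a < M" for a
    proof -
      have "x a b t = (if a = b then 0 else x a b t) + (if a = b then 1 else 0)" for b
        by (simp add: x_def)
      then have "(\<Sum>b<M. x a b t) = (\<Sum>b<M. (if a = b then 0 else x a b t) + (if a = b then 1 else 0))"
        by (intro sum.cong) auto
      then show ?thesis using that by (simp add: sum.distrib)
    qed
    then have 1: "(\<Sum>a<M. \<Sum>b<M. x a b t) = (\<Sum>a<M. \<Sum>b<M. if a = b then 0 else x a b t) + of_nat M"
      by (simp add: sum.distrib)
    have "h t = (- 1 / of_nat M) * (\<Sum>a<M. \<Sum>b<M. character k t * window t * (if a = b then 0 else x a b t))"
      unfolding h_def x_def by (intro arg_cong2[of _ _ _ _ "(*)"] refl sum.cong) (auto simp: character_add)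
    also have "\<dots> = - (character k t * window t / of_nat M) * (\<Sum>a<M. \<Sum>b<M. if a = b then 0 else x a b t)"
      by (simp only: sum_distrib_left[symmetric]) simp
    finally show ?thesis unfolding 1 using M(2) by (simp add: field_simps)
  qed
  have "norm (character k t * window t - h t) \<le> inverse (real (Suc n))" for t
  proof -
    let ?s = "norm (\<Sum>a<M. \<Sum>b<M. x a b t)"
    have "norm (character k t * window t - h t) = norm (window t) * ?s / real M"
      unfolding kernel by (simp add: norm_mult norm_divide)
    also have "norm (window t) * ?s \<le> w t * ?s"
      using w_ge_0[of t] by (intro mult_right_mono) (auto simp: norm_window indicator_def)
    also have "w t * ?s \<le> C * (norm (character N t - 1))\<^sup>2 * ?s"
      by (intro mult_right_mono C) auto
    also have "\<dots> = C * (?s * (norm (character N t - 1))\<^sup>2)" by simp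
    also have "\<dots> \<le> C * 4" using fejer_kernel_bound[where M = M and N = N and t = t] C_pos unfolding x_def by (intro mult_left_mono) auto
    finally have "norm (character k t * window t - h t) \<le> C * 4 / real M"
      using M(2) by (simp add: divide_right_mono)
    also have "\<dots> \<le> inverse (real (Suc n))" using M by (simp add: field_simps)
    finally show ?thesis .
  qed
  with hspan show ?thesis by blast
qed

lemma character_window_in_span: "(\<lambda>t. character k t * window t) \<in> closed_span system"
proof -
  obtain h where h: "\<And>n. h n \<in> linear_span system"
    and le: "\<And>n t. norm (character k t * window t - h n t) \<le> inverse (real (Suc n))"
    using character_window_approx[of k] by metis
  \<comment> \<open>Elements of \<open>system\<close> vanish off \<open>[0,1]\<close>, hence so does
    \<open>h n\<close>; this allows a majorant supported in \<open>[0,1]\<close>.\<close>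
  have hw: "h n t = 0" if "t \<notin> {0..1}" for n t
  proof -
    obtain F c where "finite F" "F \<subseteq> system" "h n = (\<lambda>t. \<Sum>s\<in>F. c s * s t)"
      using h[of n] by (auto simp: linear_span_def)
    moreover have "window t = 0" using norm_window_le[of t] that by simp
    ultimately show ?thesis by (auto simp: system_def intro!: sum.neutral)
  qed
  show ?thesis
  proof (rule L2_closure_dominated[OF linear_span_subset_L2[OF system_L2], where F = h and G = "\<lambda>t. 2 * indicator {0..1} t"])
    show "h n \<in> closed_span system" for n using h closed_span_base[OF system_L2] by blast
    show "(\<lambda>t. 2 * indicator {0..1} t :: complex) \<in> L2" by (intro L2_scale indicator_L2)
    have "norm (h n t) \<le> norm (2 * indicator {0..1} t :: complex)" for n t
    proof (cases "t \<in> {0..1}")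
      case True
      have "norm (h n t) \<le> norm (character k t * window t) + norm (character k t * window t - h n t)"
        using norm_triangle_ineq4[of "character k t * window t" "character k t * window t - h n t"] by simp
      also have "\<dots> \<le> 1 + 1"
        using order_trans[OF le[of t n], of 1] norm_window_le[of t] True
        by (intro add_mono) (auto simp: norm_mult inverse_le_1_iff)
      finally show ?thesis using True by simp
    qed (simp add: hw)
    then show "AE t in lborel. norm (h n t) \<le> norm (2 * indicator {0..1} t :: complex)" for n by simp
    have "(\<lambda>n. h n t) \<longlonglongrightarrow> character k t * window t" for t
    proof -
      have "(\<lambda>n. character k t * window t - h n t) \<longlonglongrightarrow> 0"
        by (rule Lim_null_comparison[OF _ LIMSEQ_inverse_real_of_nat]) (use le in auto)
      from tendsto_diff[OF tendsto_const[of "character k t * window t"] this] show ?thesis by simp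
    qed
    then show "AE t in lborel. (\<lambda>n. h n t) \<longlonglongrightarrow> character k t * window t" by simp
  qed measurable
qed

lemma trigonometric_window_in_span:
  assumes "p \<in> linear_span (range character)"
  shows "(\<lambda>t. p t * window t) \<in> closed_span system"
proof -
  obtain F c where F: "finite F" "F \<subseteq> range character" "p = (\<lambda>t. \<Sum>h\<in>F. c h * h t)"
    using assms by (auto simp: linear_span_def)
  have "(\<lambda>t. \<Sum>h\<in>F. c h * (h t * window t)) \<in> closed_span system"
    using F character_window_in_span by (intro closed_span_sum closed_span_scale system_L2) auto
  then show ?thesis by (simp add: F(3) sum_distrib_right mult.assoc)
qed

text \<open>Uniform approximation on \<open>[0,1]\<close> is enough because \<open>window\<close>
  vanishes elsewhere; \<open>K + 1\<close> serves as majorant since all errors are below 1.\<close>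

lemma continuous_window_in_span:
  assumes \<phi>: "continuous_on UNIV \<phi>"
  shows "(\<lambda>t. \<phi> t * window t) \<in> closed_span system"
proof -
  have [measurable]: "\<phi> \<in> borel_measurable borel" using \<phi> by (rule borel_measurable_continuous_onI)
  have cont: "continuous_on {0..1} \<phi>" using \<phi> continuous_on_subset by blast
  have "compact (\<phi> ` {0..1})" by (intro compact_continuous_image cont) simp
  then obtain K where K: "\<And>t. t \<in> {0..1} \<Longrightarrow> norm (\<phi> t) \<le> K"
    by (meson bounded_iff compact_imp_bounded imageI)
  have "\<exists>p. p \<in> linear_span (range character) \<and> (\<forall>t\<in>{0..1}. norm (\<phi> t - p t) < inverse (real (Suc n)))" for n
    by (rule trigonometric_approximation[OF cont, of "inverse (real (Suc n))"]) auto
  then obtain p where p: "\<And>n. p n \<in> linear_span (range character)"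
    and le: "\<And>n t. t \<in> {0..1} \<Longrightarrow> norm (\<phi> t - p n t) < inverse (real (Suc n))"
    by metis
  show ?thesis
  proof (rule L2_closure_dominated[OF linear_span_subset_L2[OF system_L2], where
        F = "\<lambda>n t. p n t * window t" and G = "\<lambda>t. complex_of_real (K + 1) * indicator {0..1} t"])
    show "(\<lambda>t. p n t * window t) \<in> closed_span system" for n
      by (intro trigonometric_window_in_span p)
    show "(\<lambda>t. complex_of_real (K + 1) * indicator {0..1} t) \<in> L2" by (intro L2_scale indicator_L2)
    have "norm (p n t) \<le> K + 1" if "t \<in> {0..1}" for n t
    proof -
      have "norm (p n t) \<le> norm (\<phi> t) + norm (\<phi> t - p n t)"
        using norm_triangle_ineq4[of "\<phi> t" "\<phi> t - p n t"] by simp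
      also have "inverse (real (Suc n)) \<le> 1" by (simp add: inverse_le_1_iff)
      then have "norm (\<phi> t) + norm (\<phi> t - p n t) \<le> K + 1"
        using le[OF that, of n] K[OF that] by linarith
      finally show ?thesis .
    qed
    then show "AE t in lborel. norm (p n t * window t) \<le> norm (complex_of_real (K + 1) * indicator {0..1} t)" for n
      using norm_mult_window_le[of _ "p n _" "K + 1"] by auto
    have "(\<lambda>n. p n t * window t) \<longlonglongrightarrow> \<phi> t * window t" for t
    proof (cases "t \<in> {0..1}")
      case True
      have "(\<lambda>n. \<phi> t - p n t) \<longlonglongrightarrow> 0"
        by (rule Lim_null_comparison[OF _ LIMSEQ_inverse_real_of_nat])
          (use le[OF True] in \<open>auto intro!: always_eventually less_imp_le\<close>)
      from tendsto_mult[OF tendsto_diff[OF tendsto_const[of "\<phi> t"] this] tendsto_const[of "window t"]]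
      show ?thesis by simp
    next
      case False
      then show ?thesis using norm_window_le[of t] by simp
    qed
    then show "AE t in lborel. (\<lambda>n. p n t * window t) \<longlonglongrightarrow> \<phi> t * window t" by simp
  qed measurable
qed

text \<open>A Borel function is an almost everywhere limit of continuous ones. Truncating these at
  \<open>K\<close> bounds them uniformly and, since \<open>q\<close> itself is bounded by
  \<open>K\<close>, preserves the limit.\<close>

lemma bounded_window_in_span:
  assumes q[measurable]: "q \<in> borel_measurable borel" and qK: "\<And>t. norm (q t) \<le> K" and K: "K > 0"
  shows "(\<lambda>t. q t * window t) \<in> closed_span system"
proof -
  obtain cl :: "complex \<Rightarrow> complex" where cl: "continuous_on UNIV cl" "\<And>z. norm (cl z) \<le> K"
    "\<And>z. norm z \<le> K \<Longrightarrow> cl z = z" using radial_truncation[OF K] by blast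
  \<comment> \<open>By definition \<open>measurable_on\<close> means pointwise approximation by
    continuous functions off a negligible set.\<close>
  have "q measurable_on UNIV"
    by (intro lebesgue_measurable_imp_measurable_on measurable_completion) auto
  then obtain Z c where Z: "negligible Z" and c: "\<And>n. continuous_on UNIV (c n)"
    and lim: "\<And>t. t \<notin> Z \<Longrightarrow> (\<lambda>n. c n t) \<longlonglongrightarrow> q t"
    unfolding measurable_on_def by auto
  have AEZ: "AE t in lborel. t \<notin> Z"
  proof -
    have "AE t in lebesgue. t \<notin> Z" using Z negligible_iff_null_sets AE_not_in by blast
    then show ?thesis by (simp add: AE_completion_iff)
  qed
  show ?thesis
  proof (rule L2_closure_dominated[OF linear_span_subset_L2[OF system_L2], where
        F = "\<lambda>n t. cl (c n t) * window t" and G = "\<lambda>t. complex_of_real K * indicator {0..1} t"])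
    show "(\<lambda>t. cl (c n t) * window t) \<in> closed_span system" for n
      by (intro continuous_window_in_span continuous_on_compose2[OF cl(1) c]) auto
    show "(\<lambda>t. complex_of_real K * indicator {0..1} t) \<in> L2" by (intro L2_scale indicator_L2)
    show "AE t in lborel. norm (cl (c n t) * window t) \<le> norm (complex_of_real K * indicator {0..1} t)" for n
      by (intro AE_I2 norm_mult_window_le cl(2))
    show "AE t in lborel. (\<lambda>n. cl (c n t) * window t) \<longlonglongrightarrow> q t * window t"
      using AEZ
    proof eventually_elim
      case (elim t)
      have "(\<lambda>n. cl (c n t)) \<longlonglongrightarrow> cl (q t)"
        using cl(1) lim[OF elim] by (auto intro: continuous_on_tendsto_compose)
      then show ?case using cl(3)[OF qK[of t]] by (auto intro: tendsto_intros)
    qed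
  qed measurable
qed

text \<open>Formally \<open>f = (f / w) * window\<close>. Setting the quotient to 0 where
  \<open>|f| > n * w\<close> makes it bounded, and as \<open>w\<close> is nonzero almost everywhere
  on \<open>[0,1]\<close>, the cut-off products converge to \<open>f\<close> with majorant
  \<open>f\<close> itself.\<close>

lemma L2_unit_interval_in_span:
  assumes f: "f \<in> L2" and supp: "\<And>t. t \<notin> {0..<1} \<Longrightarrow> f t = 0"
  shows "f \<in> closed_span system"
proof -
  note [measurable] = L2_measurable[OF f]
  define q where "q n t = (if norm (f t) \<le> real n * w t then f t / complex_of_real (w t) else 0)" for n t
  have [measurable]: "q n \<in> borel_measurable borel" for n unfolding q_def by measurable
  have qw: "q n t * window t = (if norm (f t) \<le> real n * w t then f t else 0)" for n t
    using supp[of t] by (auto simp: q_def window_def indicator_def)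
  show ?thesis
  proof (rule L2_closure_dominated[OF linear_span_subset_L2[OF system_L2], where
        F = "\<lambda>n t. q n t * window t" and G = f])
    show "(\<lambda>t. q n t * window t) \<in> closed_span system" for n
    proof (rule bounded_window_in_span)
      \<comment> \<open>The extra 1 keeps the bound positive at \<open>n = 0\<close>, as
        \<open>bounded_window_in_span\<close> asks.\<close>
      show "norm (q n t) \<le> real n + 1" for t
        using w_ge_0[of t] by (cases "w t = 0") (auto simp: q_def norm_divide divide_le_eq algebra_simps)
    qed auto
    show "AE t in lborel. norm (q n t * window t) \<le> norm (f t)" for n unfolding qw by auto
    show "AE t in lborel. (\<lambda>n. q n t * window t) \<longlonglongrightarrow> f t"
      using w_nonzero
    proof eventually_elim
      case (elim t)
      show ?case
      proof (cases "t \<in> {0..<1}")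
        case True
        then have wt: "w t > 0" using elim w_ge_0[of t] by (simp add: less_le)
        have "\<forall>\<^sub>F n in sequentially. q n t * window t = f t"
          unfolding qw using eventually_ge_at_top[of "nat \<lceil>norm (f t) / w t\<rceil>"]
        proof eventually_elim
          case (elim n)
          then have "norm (f t) / w t \<le> real n" by linarith
          then show ?case using wt by (simp add: divide_le_eq)
        qed
        then show ?thesis by (rule tendsto_eventually)
      qed (simp add: qw supp cong: if_cong)
    qed
  qed (use f in auto)
qed

end

section \<open>Half-integer lattices and their Beurling densities\<close>

text \<open>Translation is an isometry, so only the generators have to be moved. Landing in the
  linear span of \<open>S'\<close> rather than in \<open>S'\<close> absorbs the constant factor that
  a translated character acquires.\<close>

lemma closed_span_shift:
  assumes S: "\<And>s. s \<in> S \<Longrightarrow> (\<lambda>t. s (t - a)) \<in> linear_span S'" and f: "f \<in> closed_span S"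
  shows "(\<lambda>t. f (t - a)) \<in> closed_span S'"
proof (rule L2_closureI)
  show "(\<lambda>t. f (t - a)) \<in> L2" using f L2_closure_subset by (intro L2_shift) auto
  fix e :: real assume "e > 0"
  then obtain h where h: "h \<in> linear_span S" "L2_norm (\<lambda>t. f t - h t) < e"
    using f unfolding L2_closure_def by blast
  obtain F c where F: "finite F" "F \<subseteq> S" "h = (\<lambda>t. \<Sum>s\<in>F. c s * s t)"
    using h(1) by (auto simp: linear_span_def)
  have "(\<lambda>t. h (t - a)) \<in> linear_span S'"
    unfolding F(3) using F(1,2) by (intro linear_span_sum linear_span_scale S) auto
  moreover have "L2_norm (\<lambda>t. f (t - a) - h (t - a)) < e"
    using h(2) L2_norm_shift[of "\<lambda>t. f t - h t" a] by simp
  ultimately show "\<exists>h\<in>linear_span S'. L2_norm (\<lambda>t. f (t - a) - h t) < e"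
    by (intro bexI[of _ "\<lambda>t. h (t - a)"])
qed

text \<open>Time shifts run over all integers so that translates of the unit interval cover the
  line; the halving matches the frequency of \<open>character n\<close>.\<close>

definition half_lattice :: "int set \<Rightarrow> (real \<times> real) set" where
  "half_lattice A = (\<lambda>(x, n). (of_int x, of_int n / 2)) ` (UNIV \<times> A)"

lemma half_latticeI: "n \<in> A \<Longrightarrow> (of_int x, of_int n / 2) \<in> half_lattice A"
  by (force simp: half_lattice_def)

lemma half_latticeE:
  assumes "p \<in> half_lattice A" obtains x n where "p = (of_int x, of_int n / 2)" "n \<in> A"
  using assms by (auto simp: half_lattice_def)

lemma character_diff_arg: "character n (t - a) = character n (- a) * character n t"
  by (simp add: character_def cis_mult algebra_simps)

lemma schroedinger_half_lattice:
  "schroedinger (x, of_int n / 2) f t = character n t * f (t - x)"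
  by (simp add: schroedinger_def character_def cis_conv_exp mult_ac)

section \<open>Completeness on the whole line\<close>

context sparse_weight begin

text \<open>\<open>f\<close> is cut at the integers; each piece is moved to \<open>[0,1)\<close>,
  handled there, and moved back. Finite sums of pieces converge to \<open>f\<close> with majorant
  \<open>f\<close> itself.\<close>

lemma L2_in_closed_span:
  assumes f: "f \<in> L2" and U: "U \<subseteq> L2"
    and shift: "\<And>s a. s \<in> system \<Longrightarrow> (\<lambda>t. s (t - of_int a)) \<in> linear_span U"
  shows "f \<in> closed_span U"
proof -
  note [measurable] = L2_measurable[OF f]
  define piece where "piece a t = f t * indicator {t. \<lfloor>t\<rfloor> = a} t" for a t
  have piece: "piece a \<in> closed_span U" for a
  proof -
    define F where "F t = f (t - - of_int a) * indicator {0..<1} t" for t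
    have "(\<lambda>t. f (t - - of_int a)) \<in> L2" by (rule L2_shift[OF f])
    then have "F \<in> L2" unfolding F_def
      by (rule L2_dominated[rotated]) (auto simp: norm_mult indicator_def)
    then have "F \<in> closed_span system"
      by (rule L2_unit_interval_in_span) (auto simp: F_def)
    then have "(\<lambda>t. F (t - of_int a)) \<in> closed_span U"
      by (rule closed_span_shift[rotated]) (rule shift)
    moreover have "(\<lambda>t. F (t - of_int a)) = piece a"
      by (auto simp: F_def piece_def fun_eq_iff indicator_def floor_eq_iff)
    ultimately show ?thesis by simp
  qed
  have sum_piece: "(\<Sum>a\<in>{- int n..int n}. piece a t) = (if \<lfloor>t\<rfloor> \<in> {- int n..int n} then f t else 0)" for n t
    by (simp add: piece_def indicator_def sum.delta')
  show ?thesis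
  proof (rule L2_closure_dominated[OF linear_span_subset_L2[OF U], where
        F = "\<lambda>n t. \<Sum>a\<in>{- int n..int n}. piece a t" and G = f])
    show "(\<lambda>t. \<Sum>a\<in>{- int n..int n}. piece a t) \<in> closed_span U" for n
      by (intro closed_span_sum U piece) auto
    show "AE t in lborel. norm (\<Sum>a\<in>{- int n..int n}. piece a t) \<le> norm (f t)" for n
      unfolding sum_piece by simp
    have "(\<lambda>n. \<Sum>a\<in>{- int n..int n}. piece a t) \<longlonglongrightarrow> f t" for t
    proof (rule tendsto_eventually)
      show "\<forall>\<^sub>F n in sequentially. (\<Sum>a\<in>{- int n..int n}. piece a t) = f t"
        unfolding sum_piece using eventually_ge_at_top[of "nat \<bar>\<lfloor>t\<rfloor>\<bar>"]
        by eventually_elim auto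
    qed
    then show "AE t in lborel. (\<lambda>n. \<Sum>a\<in>{- int n..int n}. piece a t) \<longlonglongrightarrow> f t" by simp
  qed (use f in auto)
qed

text \<open>The frequencies in \<open>B\<close> already span, which leaves \<open>A\<close> free to
  be enlarged for the sake of symmetry and relative density.\<close>

lemma complete_family_half_lattice:
  assumes "B \<subseteq> A"
  shows "complete_family (\<lambda>z. schroedinger z window) (half_lattice A)"
proof -
  let ?U = "(\<lambda>z. schroedinger z window) ` half_lattice A"
  have U: "?U \<subseteq> L2"
  proof
    fix u assume "u \<in> ?U"
    then obtain x n where "u = schroedinger (of_int x, of_int n / 2) window"
      by (auto elim!: half_latticeE)
    then have u: "u = (\<lambda>t. character n t * window (t - of_int x))"
      by (simp add: fun_eq_iff schroedinger_half_lattice)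
    show "u \<in> L2" unfolding u
      by (rule L2_dominated[OF _ L2_shift[OF window_L2, of "of_int x"]]) (auto simp: norm_mult)
  qed
  have "(\<lambda>t. s (t - of_int a)) \<in> linear_span ?U" if s: "s \<in> system" for s a
  proof -
    obtain n where n: "n \<in> B" "s = (\<lambda>t. character n t * window t)"
      using s by (auto simp: system_def)
    have "schroedinger (of_int a, of_int n / 2) window \<in> linear_span ?U"
      using n assms by (intro linear_span_base imageI half_latticeI) auto
    \<comment> \<open>A time shift by \<open>a\<close> of \<open>character n\<close> times
      \<open>window\<close> differs from the orbit element at \<open>(a, n / 2)\<close> only by the
      constant \<open>character n (- a)\<close>.\<close>
    from linear_span_scale[OF this, of "character n (- of_int a)"] show ?thesis
      unfolding n(2) schroedinger_half_lattice character_diff_arg by (simp only: mult.assoc)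
  qed
  then have "closed_span ?U = L2"
    using L2_in_closed_span[OF _ U] L2_closure_subset by blast
  with U show ?thesis by (simp add: complete_family_def)
qed

end

section \<open>The approximate lattice property\<close>

lemma uminus_image_eqI:
  fixes X :: "'a::group_add set"
  assumes "\<And>x. x \<in> X \<Longrightarrow> - x \<in> X" shows "uminus ` X = X"
proof
  show "X \<subseteq> uminus ` X"
  proof
    fix x assume "x \<in> X"
    then show "x \<in> uminus ` X" by (intro image_eqI[of _ _ "- x"] assms) simp_all
  qed
qed (use assms in auto)

text \<open>Distinct points differ by at least 1 in time or 1/2 in frequency, while points in a
  common ball of radius 1/4 are less than 1/2 apart in each coordinate.\<close>

lemma uniformly_discrete_half_lattice: "uniformly_discrete (half_lattice A)"
  unfolding uniformly_discrete_def
proof (intro exI[of _ "ball 0 (1/4)"] conjI allI)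
  fix x :: "real \<times> real"
  have eq: "p = q" if p: "p \<in> half_lattice A \<inter> (+) x ` ball 0 (1/4)"
    and q: "q \<in> half_lattice A \<inter> (+) x ` ball 0 (1/4)" for p q
  proof -
    have "dist x p < 1/4" "dist x q < 1/4" using p q by (auto simp: dist_norm)
    then have "dist p q < 1/2" using dist_triangle_half_r[of x p "1/2" q] by simp
    then have d: "dist (fst p) (fst q) < 1/2" "dist (snd p) (snd q) < 1/2"
      using dist_fst_le[of p q] dist_snd_le[of p q] by linarith+
    obtain a n b m where pq: "p = (of_int a, of_int n / 2)" "q = (of_int b, of_int m / 2)"
      using p q by (auto elim!: half_latticeE)
    have "\<bar>real_of_int a - of_int b\<bar> < 1/2" "\<bar>of_int n / 2 - of_int m / 2 :: real\<bar> < 1/2"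
      using d unfolding pq dist_real_def fst_conv snd_conv .
    then have "a = b" "n = m" by linarith+
    then show ?thesis using pq by simp
  qed
  let ?S = "half_lattice A \<inter> (+) x ` ball 0 (1/4)"
  have fin: "finite ?S"
  proof (cases "?S = {}")
    case False
    then obtain p where "p \<in> ?S" by blast
    then have "?S \<subseteq> {p}" using eq by blast
    then show ?thesis by (rule finite_subset) simp
  qed simp
  then show "finite ?S" .
  show "card ?S \<le> 1" using card_le_Suc0_iff_eq[OF fin] eq unfolding One_nat_def by blast
qed auto

text \<open>Division of \<open>n + m\<close> by \<open>D\<close> writes a sum of two points as one
  of \<open>D\<close> remainders plus a point over a multiple of \<open>D\<close>, which lies in the
  set by \<open>mult\<close>. Beyond these multiples and the symmetry, \<open>A\<close> may be
  irregular.\<close>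

lemma uniform_approximate_lattice_half_lattice:
  assumes D: "D \<ge> 1" and A0: "0 \<in> A" and sym: "uminus ` A = A" and mult: "\<And>m. D * m \<in> A"
  shows "uniform_approximate_lattice (half_lattice A)"
  unfolding uniform_approximate_lattice_def delone_def
proof (intro conjI uniformly_discrete_half_lattice)
  have D': "real_of_int D > 0" using D by linarith
  show "relatively_dense (half_lattice A)"
    unfolding relatively_dense_def
  \<comment> \<open>The rectangle is a closed fundamental domain of the sublattice over the
    multiples of \<open>D\<close>.\<close>
  proof (intro exI[of _ "{0..1} \<times> {0..real_of_int D / 2}"] conjI)
    show "half_lattice A + {0..1} \<times> {0..real_of_int D / 2} = UNIV"
    proof (intro set_eqI iffI UNIV_I)
      fix z :: "real \<times> real"
      define m where "m = \<lfloor>2 * snd z / real_of_int D\<rfloor>"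
      have "(of_int \<lfloor>fst z\<rfloor>, of_int (D * m) / 2) \<in> half_lattice A"
        by (rule half_latticeI[OF mult])
      moreover have "of_int m \<le> 2 * snd z / real_of_int D" "2 * snd z / real_of_int D \<le> of_int m + 1"
        unfolding m_def by linarith+
      then have "z - (of_int \<lfloor>fst z\<rfloor>, of_int (D * m) / 2) \<in> {0..1} \<times> {0..real_of_int D / 2}"
        using D' by (cases z) (auto simp: field_simps, linarith)
      ultimately have "(of_int \<lfloor>fst z\<rfloor>, of_int (D * m) / 2) + (z - (of_int \<lfloor>fst z\<rfloor>, of_int (D * m) / 2))
          \<in> half_lattice A + {0..1} \<times> {0..real_of_int D / 2}" by (rule set_plus_intro)
      then show "z \<in> half_lattice A + {0..1} \<times> {0..real_of_int D / 2}" by simp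
    qed
  qed (intro compact_Times compact_Icc)
  show "0 \<in> half_lattice A" using half_latticeI[OF A0, of 0] by (simp add: zero_prod_def)
  show "uminus ` half_lattice A = half_lattice A"
  proof (rule uminus_image_eqI)
    fix p assume "p \<in> half_lattice A"
    then obtain x n where p: "p = (of_int x, of_int n / 2)" "n \<in> A" by (rule half_latticeE)
    then have "- n \<in> A" using sym by blast
    from half_latticeI[OF this, of "- x"] show "- p \<in> half_lattice A" by (simp add: p)
  qed
  let ?F = "(\<lambda>j. (0, of_int j / 2)) ` {0..<D} :: (real \<times> real) set"
  have "half_lattice A + half_lattice A \<subseteq> ?F + half_lattice A"
  proof
    fix p assume "p \<in> half_lattice A + half_lattice A"
    then obtain x n y m where p: "p = (of_int x, of_int n / 2) + (of_int y, of_int m / 2)"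
      by (auto elim!: set_plus_elim half_latticeE)
    let ?q = "(of_int (x + y), of_int (D * ((n + m) div D)) / 2) :: real \<times> real"
    have "of_int (n + m) = real_of_int ((n + m) mod D + D * ((n + m) div D))" by simp
    then have "p = (0, of_int ((n + m) mod D) / 2) + ?q"
      unfolding p by (simp only: of_int_add) (simp add: add_divide_distrib)
    moreover have "(0, of_int ((n + m) mod D) / 2) \<in> ?F" using D by simp
    moreover have "?q \<in> half_lattice A" by (rule half_latticeI[OF mult])
    ultimately show "p \<in> ?F + half_lattice A" by (metis set_plus_intro)
  qed
  then show "\<exists>F. finite F \<and> half_lattice A + half_lattice A \<subseteq> F + half_lattice A"
    by (intro exI[of _ ?F]) simp
qed

section \<open>Counting points and Beurling densities\<close>

lemma translation_eq_vimage: "(+) x ` T = (+) (- x) -` T" for x :: "'a::group_add"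
proof
  show "(+) (- x) -` T \<subseteq> (+) x ` T"
  proof
    fix z assume "z \<in> (+) (- x) -` T"
    then show "z \<in> (+) x ` T" by (intro image_eqI[of _ _ "- x + z"]) (auto simp: add.assoc[symmetric])
  qed
qed (auto simp: add.assoc[symmetric])

lemma emeasure_lborel_translate:
  fixes T :: "'a::euclidean_space set"
  assumes "T \<in> sets borel" shows "emeasure lborel ((+) x ` T) = emeasure lborel T"
proof -
  have "emeasure lborel T = emeasure (distr lborel borel ((+) (- x))) T" by (simp add: lborel_distr_plus)
  also have "\<dots> = emeasure lborel ((+) (- x) -` T \<inter> space lborel)" using assms by (intro emeasure_distr) auto
  finally show ?thesis by (simp add: translation_eq_vimage)
qed

text \<open>A packing argument: boxes of size 1 by \<open>D / 2\<close> with lower left corners at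
  the points are disjoint by separation and lie in the translate by \<open>x\<close> of the
  thickened \<open>K\<close>, so their total area is bounded.\<close>

lemma count_separated_half_lattice:
  fixes K :: "(real \<times> real) set"
  assumes sep: "separated D S" and D: "D \<ge> 1" and K: "K + cbox 0 (1, real_of_int D / 2) \<in> sets borel"
  shows "ennreal (real_of_int D / 2) * emeasure (count_space UNIV) (half_lattice S \<inter> (+) x ` K)
    \<le> emeasure lborel (K + cbox 0 (1, real_of_int D / 2))"
proof -
  define d where "d = real_of_int D / 2"
  have d: "d > 0" using D by (simp add: d_def)
  let ?X = "half_lattice S \<inter> (+) x ` K"
  \<comment> \<open>The boxes are open, so that those of points exactly 1 or \<open>D / 2\<close>
    apart do not meet.\<close>
  define Q where "Q p = box p (p + (1, d))" for p :: "real \<times> real"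
  have Q: "q \<in> Q p \<longleftrightarrow> fst p < fst q \<and> fst q < fst p + 1 \<and> snd p < snd q \<and> snd q < snd p + d" for p q
    by (cases p; cases q) (auto simp: Q_def mem_box Basis_prod_def inner_prod_def)
  have mQ: "emeasure lborel (Q p) = ennreal d" for p
    unfolding Q_def using d by (subst emeasure_lborel_box) (auto simp: Basis_prod_def inner_prod_def prod_ennreal)
  have disj: "disjoint_family_on Q ?X"
    unfolding disjoint_family_on_def
  proof (intro ballI impI, rule ccontr)
    fix p q assume p: "p \<in> ?X" and q: "q \<in> ?X" and ne: "p \<noteq> q" and "Q p \<inter> Q q \<noteq> {}"
    then obtain z where z: "z \<in> Q p" "z \<in> Q q" by blast
    obtain a n b m where pq: "p = (of_int a, of_int n / 2)" "n \<in> S" "q = (of_int b, of_int m / 2)" "m \<in> S"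
      using p q by (auto elim!: half_latticeE)
    have "\<bar>real_of_int a - of_int b\<bar> < 1" "\<bar>real_of_int n - of_int m\<bar> < of_int D"
      using z unfolding Q pq d_def by (auto simp: abs_less_iff)
    then have "a = b" "\<bar>n - m\<bar> < D" by linarith+
    moreover have "n \<noteq> m" using ne pq \<open>a = b\<close> by auto
    ultimately show False using sep pq unfolding separated_def by force
  qed
  have "countable (half_lattice S)" unfolding half_lattice_def by (intro countable_image) simp
  then have cnt: "countable ?X" by (rule countable_subset[rotated]) auto
  have "ennreal d * emeasure (count_space UNIV) ?X = (\<integral>\<^sup>+p. emeasure lborel (Q p) \<partial>count_space ?X)"
    by (cases "finite ?X") (simp_all add: mQ emeasure_count_space)
  also have "\<dots> = emeasure lborel (\<Union>p\<in>?X. Q p)"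
    by (intro emeasure_UN_countable[symmetric] cnt disj) (simp add: Q_def)
  also have "\<dots> \<le> emeasure lborel ((+) x ` (K + cbox 0 (1, d)))"
  proof (rule emeasure_mono)
    show "(\<Union>p\<in>?X. Q p) \<subseteq> (+) x ` (K + cbox 0 (1, d))"
    proof
      fix z assume "z \<in> (\<Union>p\<in>?X. Q p)"
      then obtain k where k: "k \<in> K" "z \<in> Q (x + k)" by blast
      have "z - (x + k) \<in> cbox 0 (1, d)"
        using k(2) unfolding Q by (cases z; cases x; cases k) (auto simp: cbox_Pair_eq zero_prod_def)
      then have "k + (z - (x + k)) \<in> K + cbox 0 (1, d)" using k(1) by (intro set_plus_intro)
      then show "z \<in> (+) x ` (K + cbox 0 (1, d))" by (rule rev_image_eqI) simp
    qed
    show "(+) x ` (K + cbox 0 (1, d)) \<in> sets lborel"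
      unfolding translation_eq_vimage
      using measurable_sets_borel[of "(+) (- x)" borel "K + cbox 0 (1, d)"] K by (simp add: d_def)
  qed
  also have "\<dots> = emeasure lborel (K + cbox 0 (1, d))"
    using K by (intro emeasure_lborel_translate) (simp add: d_def)
  finally show ?thesis by (simp add: d_def)
qed

text \<open>\<open>K + Q\<close> is covered by \<open>K\<close> and the symmetric difference. The
  assumed bound on the latter holds eventually along a strong Folner sequence when \<open>Q\<close>
  is nonempty.\<close>

lemma emeasure_compact_plus_le:
  fixes K Q :: "'a::euclidean_space set"
  assumes "compact K" "compact Q" and le: "measure lborel (sym_diff K (K + Q)) \<le> measure lborel K"
  shows "K + Q \<in> sets borel" "emeasure lborel (K + Q) \<le> ennreal (2 * measure lborel K)"
proof -
  have "K + Q = (\<Union>x\<in>K. \<Union>y\<in>Q. {x + y})" unfolding set_plus_def by blast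
  then have cKQ: "compact (K + Q)" using assms by (simp add: compact_sums')
  then show s: "K + Q \<in> sets borel" by (rule borel_compact)
  have fm: "K \<in> fmeasurable lborel" "K + Q \<in> fmeasurable lborel"
    using assms(1) cKQ fmeasurable_compact by blast+
  then have fs: "sym_diff K (K + Q) \<in> fmeasurable lborel" by blast
  have "measure lborel (K + Q) \<le> measure lborel (K \<union> sym_diff K (K + Q))"
    using fm fs by (intro measure_mono_fmeasurable) auto
  also have "\<dots> \<le> measure lborel K + measure lborel (sym_diff K (K + Q))"
    using fm fs by (intro measure_Un_le) auto
  finally have "measure lborel (K + Q) \<le> 2 * measure lborel K" using le by simp
  then show "emeasure lborel (K + Q) \<le> ennreal (2 * measure lborel K)"
    using fm by (subst emeasure_eq_measure2) (auto simp: ennreal_leI fmeasurable_def)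
qed

text \<open>If \<open>K\<close> has measure \<open>mu\<close>, each of the \<open>k\<close>
  separated pieces has at most \<open>2 * mu / (D / 2) = 4 * mu / D\<close> points in a translate of
  \<open>K\<close>; the factor 2 pays for the thickening.\<close>

lemma counting_ratio_half_lattice_le:
  assumes A: "A = (\<Union>i<k. S i)" and sep: "\<And>i. i < k \<Longrightarrow> separated D (S i)" and D: "D \<ge> 1"
    and K: "compact K" "measure lborel K > 0"
    and le: "measure lborel (sym_diff K (K + cbox 0 (1, real_of_int D / 2))) \<le> measure lborel K"
  shows "counting_ratio (half_lattice A) K x \<le> ennreal (4 * real k / of_int D)"
proof -
  let ?Q = "cbox 0 (1, real_of_int D / 2) :: (real \<times> real) set"
  define d where "d = real_of_int D / 2"
  define \<mu> where "\<mu> = measure lborel K"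
  have d: "d > 0" using D by (simp add: d_def)
  have mu: "\<mu> > 0" using K by (simp add: \<mu>_def)
  note KQ = emeasure_compact_plus_le[OF K(1) compact_cbox le]
  let ?c = "\<lambda>S. emeasure (count_space UNIV) (half_lattice S \<inter> (+) x ` K)"
  have "half_lattice A \<inter> (+) x ` K = (\<Union>i<k. half_lattice (S i) \<inter> (+) x ` K)"
    unfolding A half_lattice_def by blast
  moreover have "emeasure (count_space UNIV) (\<Union>i<k. half_lattice (S i) \<inter> (+) x ` K) \<le> (\<Sum>i<k. ?c (S i))"
    by (intro emeasure_subadditive_finite) auto
  ultimately have "?c A \<le> (\<Sum>i<k. ?c (S i))" by (simp only:)
  then have "ennreal d * ?c A \<le> ennreal d * (\<Sum>i<k. ?c (S i))" by (rule mult_left_mono) simp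
  also have "\<dots> = (\<Sum>i<k. ennreal d * ?c (S i))" by (rule sum_distrib_left)
  also have "\<dots> \<le> (\<Sum>i<k. ennreal (2 * \<mu>))"
    unfolding d_def \<mu>_def
    by (intro sum_mono order_trans[OF count_separated_half_lattice[OF sep D KQ(1)] KQ(2)]) simp
  also have "\<dots> = ennreal (real k * (2 * \<mu>))" using mu by (simp add: ennreal_mult ennreal_of_nat_eq_real_of_nat)
  finally have le: "ennreal d * ?c A \<le> ennreal (real k * (2 * \<mu>))" .
  have emu: "emeasure lborel K = ennreal \<mu>"
    unfolding \<mu>_def using fmeasurable_compact[OF K(1)] by (intro emeasure_eq_measure2) (auto simp: fmeasurable_def)
  show ?thesis
  proof (cases "?c A")
    case (real r)
    then have "d * r \<le> real k * (2 * \<mu>)" using le d mu by (simp add: ennreal_mult[symmetric])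
    then have "r / \<mu> \<le> 4 * real k / of_int D"
      using D mu by (simp add: d_def field_simps)
    then show ?thesis unfolding counting_ratio_def emu real using mu real by (simp add: divide_ennreal ennreal_leI)
  next
    case top
    then show ?thesis using le d by (simp add: ennreal_mult_top top_unique)
  qed
qed

text \<open>The Folner condition for the single test set \<open>?Q\<close> eventually yields the
  hypothesis of \<open>counting_ratio_half_lattice_le\<close>, whose bound is uniform in the
  translate.\<close>

lemma beurling_density_half_lattice_le:
  assumes A: "A = (\<Union>i<k. S i)" and sep: "\<And>i. i < k \<Longrightarrow> separated D (S i)" and D: "D \<ge> 1"
    and Kn: "strong_folner Kn"
  shows "upper_beurling_density Kn (half_lattice A) \<le> ennreal (4 * real k / of_int D)"
    and "lower_beurling_density Kn (half_lattice A) \<le> ennreal (4 * real k / of_int D)"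
proof -
  let ?Q = "cbox 0 (1, real_of_int D / 2) :: (real \<times> real) set"
  have "0 \<in> ?Q" using D by (simp add: cbox_Pair_eq zero_prod_def)
  then have "?Q \<noteq> {}" by blast
  then have "(\<lambda>n. measure lborel (sym_diff (Kn n) (Kn n + ?Q)) / measure lborel (Kn n)) \<longlonglongrightarrow> 0"
    using Kn compact_cbox unfolding strong_folner_def by blast
  then have "\<forall>\<^sub>F n in sequentially. measure lborel (sym_diff (Kn n) (Kn n + ?Q)) / measure lborel (Kn n) < 1"
    by (rule order_tendstoD) simp
  then have ev: "\<forall>\<^sub>F n in sequentially. \<forall>x. counting_ratio (half_lattice A) (Kn n) x \<le> ennreal (4 * real k / of_int D)"
  proof eventually_elim
    case (elim n)
    have K: "compact (Kn n)" "measure lborel (Kn n) > 0" using Kn unfolding strong_folner_def by blast+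
    then have "measure lborel (sym_diff (Kn n) (Kn n + ?Q)) \<le> measure lborel (Kn n)"
      using elim by (simp add: divide_less_eq)
    then show ?case using counting_ratio_half_lattice_le[OF A sep D K] by blast
  qed
  then show "upper_beurling_density Kn (half_lattice A) \<le> ennreal (4 * real k / of_int D)"
    unfolding upper_beurling_density_def
    by (intro Limsup_bounded) (auto elim!: eventually_mono intro: SUP_least)
  have "lower_beurling_density Kn (half_lattice A) \<le> limsup (\<lambda>n. INF x. counting_ratio (half_lattice A) (Kn n) x)"
    unfolding lower_beurling_density_def by (intro Liminf_le_Limsup) simp
  also have "\<dots> \<le> ennreal (4 * real k / of_int D)"
    using ev by (intro Limsup_bounded) (auto elim!: eventually_mono intro: INF_lower2)
  finally show "lower_beurling_density Kn (half_lattice A) \<le> ennreal (4 * real k / of_int D)" .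
qed

section \<open>Assembling the approximate lattice and the window\<close>

theorem proposition3p7:
  fixes \<epsilon> :: real
  assumes "\<epsilon> > 0"
  shows "\<exists>(\<Lambda>' :: (real \<times> real) set) (g :: real \<Rightarrow> complex).
           uniform_approximate_lattice \<Lambda>' \<and> g \<in> L2 \<and>
           complete_family (\<lambda>z. schroedinger z g) \<Lambda>' \<and>
           (\<forall>Kn. strong_folner Kn \<longrightarrow>
              upper_beurling_density Kn \<Lambda>' < ennreal \<epsilon> \<and>
              lower_beurling_density Kn \<Lambda>' < ennreal \<epsilon>)"
proof -
  \<comment> \<open>Three \<open>D\<close>-separated pieces give density at most
    \<open>4 * 3 / D\<close>, which is below \<open>\<epsilon>\<close> as soon as
    \<open>D > 12 / \<epsilon>\<close>.\<close>
  define D where "D = \<lfloor>12 / \<epsilon>\<rfloor> + 1"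
  have "real_of_int D > 12 / \<epsilon>" unfolding D_def by linarith
  moreover have "12 / \<epsilon> > 0" using assms by simp
  ultimately have D: "D \<ge> 1" by linarith
  with \<open>real_of_int D > 12 / \<epsilon>\<close> have De: "12 / real_of_int D < \<epsilon>"
    using assms by (simp add: field_simps)
  obtain B w where sep: "separated D B" and w: "w \<in> borel_measurable borel" "\<And>t. 0 \<le> w t" "\<And>t. w t \<le> 1"
    "AE t in lborel. t \<in> {0..1} \<longrightarrow> w t \<noteq> 0"
    "\<And>k n. \<exists>N M C. (\<forall>a<M. \<forall>b<M. a \<noteq> b \<longrightarrow> k + (int a - int b) * N \<in> B) \<and>
       (\<forall>t. w t \<le> C * (norm (character N t - 1))\<^sup>2) \<and> 4 * C * real (Suc n) \<le> real M \<and> M > 0 \<and> C > 0"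
    using sparse_frequencies_and_weight[OF D] by blast
  interpret sparse_weight B w by unfold_locales (fact w)+
  \<comment> \<open>\<open>B\<close> gives completeness, its reflection gives symmetry, and the
    multiples of \<open>D\<close> give 0, relative density and the finite set of remainders. Each
    piece is \<open>D\<close>-separated on its own, although the union is not claimed to be.\<close>
  define S where "S i = (if i = 0 then B else if i = 1 then uminus ` B else range ((*) D))" for i :: nat
  define A where "A = (\<Union>i<3. S i)"
  have Aeq: "A = B \<union> uminus ` B \<union> range ((*) D)"
    by (auto simp: A_def S_def lessThan_nat_numeral lessThan_Suc numeral_3_eq_3)
  have "separated D (uminus ` B)" using sep unfolding separated_def by fastforce
  moreover have "separated D (range ((*) D))"
    unfolding separated_def
  proof (intro ballI impI)
    fix a b assume "a \<in> range ((*) D)" "b \<in> range ((*) D)" "a \<noteq> b"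
    then have "D dvd a - b" "a - b \<noteq> 0" by auto
    then show "D \<le> \<bar>a - b\<bar>" by (intro zdvd_imp_le) auto
  qed
  ultimately have S: "separated D (S i)" for i using sep by (simp add: S_def)
  have "12 / real_of_int D > 0" using D by simp
  then have lt: "ennreal (4 * real 3 / real_of_int D) < ennreal \<epsilon>" using De assms by (simp add: ennreal_lessI)
  show ?thesis
  proof (intro exI conjI allI impI)
    have "- (D * m) \<in> range ((*) D)" for m by (rule range_eqI[of _ _ "- m"]) simp
    then have "- a \<in> A" if "a \<in> A" for a using that unfolding Aeq by auto
    then have "uminus ` A = A" by (rule uminus_image_eqI)
    moreover have "D * m \<in> A" for m unfolding Aeq by blast
    moreover have "0 \<in> A" using \<open>\<And>m. D * m \<in> A\<close>[of 0] by simp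
    ultimately show "uniform_approximate_lattice (half_lattice A)"
      by (intro uniform_approximate_lattice_half_lattice[OF D])
    show "window \<in> L2" by (rule window_L2)
    show "complete_family (\<lambda>z. schroedinger z window) (half_lattice A)"
      by (rule complete_family_half_lattice) (auto simp: Aeq)
    fix Kn assume Kn: "strong_folner Kn"
    show "upper_beurling_density Kn (half_lattice A) < ennreal \<epsilon>"
      "lower_beurling_density Kn (half_lattice A) < ennreal \<epsilon>"
      using beurling_density_half_lattice_le[OF A_def S D Kn] lt by (auto intro: le_less_trans)
  qed
qed

end
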